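(* Let $(X,\Gamma)$ be a topological dynamical system, where $\Gamma$ is a nilpotent group such that for each $T\in\Gamma$ with $T\neq e_\Gamma$ the system $(X,T)$ is weakly mixing and minimal. Let $k\in\mathbb{N}$, let $T_1,\ldots,T_k\in\Gamma$ and $p_1,\ldots,p_k\in\mathcal{P}_0$ be such that the expression $$g(n)=T_1^{p_1(n)}\cdots T_k^{p_k(n)}$$ depends nontrivially on $n$. Then there is a dense $G_\delta$ subset $X_0$ of $X$ such that for each $x\in X_0$ and each non-empty open subset $U$ of $X$ the set $$N_g(x,U):=\{n\in\mathbb{Z}: g(n)x\in U\}$$ is piecewise syndetic.
   Context: A topological dynamical system $(X,\Gamma)$ consists of a compact metric space $X$ and a Hausdorff topological group $\Gamma$ with unit $e_\Gamma$ acting on $X$ by a continuous action map $\Gamma\times X\to X$. For $T\in\Gamma$, $(X,T)$ denotes the $\mathbb{Z}$-action on $X$ generated by $T$. A system is minimal if $X$ contains no proper non-empty closed invariant subset; it is transitive if every non-empty invariant open subset is dense; it is weakly mixing if the product system $X\times X$ (with the diagonal action) is transitive. $\mathcal{P}_0$ is the set of polynomials $p$ with rational coefficients taking integer values on the integers and with $p(0)=0$. A map $g:\mathbb{Z}\to\Gamma$ "depends nontrivially on $n$" if it is a nonconstant map. A set $S\subseteq\mathbb{Z}$ is syndetic if there is $N\in\mathbb{N}$ with $\{i,i+1,\ldots,i+N\}\cap S\neq\emptyset$ for every $i\in\mathbb{Z}$; it is thick if it contains arbitrarily long runs of consecutive integers; it is piecewise syndetic if it is the intersection of a syndetic set with a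 thick set. *)

theory Defs
  imports
    "HOL-Analysis.Analysis"
    "HOL-Algebra.Group_Action"
    "HOL-Algebra.Elementary_Groups"
    "HOL-Computational_Algebra.Polynomial"
begin

section \<open>Nilpotent groups\<close>

primrec lower_central_series :: "('g, 'm) monoid_scheme \<Rightarrow> nat \<Rightarrow> 'g set" where
  "lower_central_series G 0 = carrier G"
| "lower_central_series G (Suc n) =
     generate G (\<Union>a \<in> lower_central_series G n. \<Union>b \<in> carrier G.
       {a \<otimes>\<^bsub>G\<^esub> b \<otimes>\<^bsub>G\<^esub> inv\<^bsub>G\<^esub> a \<otimes>\<^bsub>G\<^esub> inv\<^bsub>G\<^esub> b})"

definition nilpotent_group :: "('g, 'm) monoid_scheme \<Rightarrow> bool" where
  "nilpotent_group G \<longleftrightarrow> group G \<and> (\<exists>n. lower_central_series G n = {\<one>\<^bsub>G\<^esub>})"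


section \<open>Topological dynamical systems\<close>

locale hausdorff_topological_group = group G for G (structure) +
  fixes \<tau> :: "'a topology"
  assumes topspace_eq: "topspace \<tau> = carrier G"
    and Hausdorff: "Hausdorff_space \<tau>"
    and continuous_mult: "continuous_map (prod_topology \<tau> \<tau>) \<tau> (\<lambda>(g, h). g \<otimes> h)"
    and continuous_inv: "continuous_map \<tau> \<tau> (\<lambda>g. inv g)"

text \<open>
  The action is given as in the library's locale \<^locale>\<open>group_action\<close>, that is, as a homomorphism
  from \<open>G\<close> to the group of bijections of the space; elements of that group are extensional
  (undefined outside the space).
\<close>

locale topological_dynamical_system =
  hausdorff_topological_group G \<tau> + group_action G "mspace X" \<phi>
  for G (structure) and \<tau> and X :: "'x metric" and \<phi> +
  assumes compact: "compact_space (mtopology_of X)"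
    and continuous_action:
      "continuous_map (prod_topology \<tau> (mtopology_of X)) (mtopology_of X) (\<lambda>(g, x). \<phi> g x)"

definition invariant_set :: "('g, 'm) monoid_scheme \<Rightarrow> ('g \<Rightarrow> 'x \<Rightarrow> 'x) \<Rightarrow> 'x set \<Rightarrow> bool" where
  "invariant_set G \<phi> A \<longleftrightarrow> (\<forall>g \<in> carrier G. \<phi> g ` A \<subseteq> A)"

definition minimal_system ::
    "('g, 'm) monoid_scheme \<Rightarrow> 'x metric \<Rightarrow> ('g \<Rightarrow> 'x \<Rightarrow> 'x) \<Rightarrow> bool" where
  "minimal_system G X \<phi> \<longleftrightarrow>
     \<not> (\<exists>A. A \<subset> mspace X \<and> A \<noteq> {} \<and> closedin (mtopology_of X) A \<and> invariant_set G \<phi> A)"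

definition transitive_system ::
    "('g, 'm) monoid_scheme \<Rightarrow> 'x metric \<Rightarrow> ('g \<Rightarrow> 'x \<Rightarrow> 'x) \<Rightarrow> bool" where
  "transitive_system G X \<phi> \<longleftrightarrow>
     (\<forall>V. openin (mtopology_of X) V \<and> V \<noteq> {} \<and> invariant_set G \<phi> V
          \<longrightarrow> mtopology_of X closure_of V = mspace X)"

definition diagonal_action :: "'x metric \<Rightarrow> ('g \<Rightarrow> 'x \<Rightarrow> 'x) \<Rightarrow> 'g \<Rightarrow> 'x \<times> 'x \<Rightarrow> 'x \<times> 'x" where
  "diagonal_action X \<phi> g = (\<lambda>z \<in> mspace X \<times> mspace X. (\<phi> g (fst z), \<phi> g (snd z)))"

definition weakly_mixing_system ::
    "('g, 'm) monoid_scheme \<Rightarrow> 'x metric \<Rightarrow> ('g \<Rightarrow> 'x \<Rightarrow> 'x) \<Rightarrow> bool" where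
  "weakly_mixing_system G X \<phi> \<longleftrightarrow>
     transitive_system G (prod_metric X X) (diagonal_action X \<phi>)"

text \<open>The system \<open>(X, S)\<close> is \<open>X\<close> with this action of \<^const>\<open>integer_group\<close>.\<close>

definition cyclic_action ::
    "('g, 'm) monoid_scheme \<Rightarrow> ('g \<Rightarrow> 'x \<Rightarrow> 'x) \<Rightarrow> 'g \<Rightarrow> int \<Rightarrow> 'x \<Rightarrow> 'x" where
  "cyclic_action G \<phi> S n = \<phi> (S [^]\<^bsub>G\<^esub> n)"


section \<open>Integer-valued polynomials and polynomial expressions in a group\<close>

definition integral_polys_0 :: "rat poly set" (\<open>\<P>\<^sub>0\<close>) where
  "\<P>\<^sub>0 = {p. (\<forall>n::int. poly p (of_int n) \<in> \<int>) \<and> poly p 0 = 0}"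

text \<open>
  \<open>T\<^sub>1\<^bsup>p\<^sub>1(n)\<^esup> \<cdots> T\<^sub>k\<^bsup>p\<^sub>k(n)\<^esup>\<close>, multiplied in this order. The floor only converts the value, which
  is an integer for polynomials in \<^const>\<open>integral_polys_0\<close>, to type \<^typ>\<open>int\<close>.
\<close>

definition poly_expression ::
    "('g, 'm) monoid_scheme \<Rightarrow> nat \<Rightarrow> (nat \<Rightarrow> 'g) \<Rightarrow> (nat \<Rightarrow> rat poly) \<Rightarrow> int \<Rightarrow> 'g" where
  "poly_expression G k T p n =
     foldr (\<otimes>\<^bsub>G\<^esub>) (map (\<lambda>i. T i [^]\<^bsub>G\<^esub> \<lfloor>poly (p i) (of_int n)\<rfloor>) [1..<Suc k]) \<one>\<^bsub>G\<^esub>"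


section \<open>Large sets of integers\<close>

definition syndetic :: "int set \<Rightarrow> bool" where
  "syndetic S \<longleftrightarrow> (\<exists>N::nat. \<forall>i. {i..i + int N} \<inter> S \<noteq> {})"

definition thick :: "int set \<Rightarrow> bool" where
  "thick S \<longleftrightarrow> (\<forall>L::nat. \<exists>i. {i..i + int L} \<subseteq> S)"

definition piecewise_syndetic :: "int set \<Rightarrow> bool" where
  "piecewise_syndetic S \<longleftrightarrow> (\<exists>A B. syndetic A \<and> thick B \<and> S = A \<inter> B)"

end

theory Submission
  imports Defs
begin

text \<open>
  Sequences \<open>f : \<int> \<rightarrow> G\<close> all of whose \<open>k\<close>-fold differences take values in the \<open>(i + k)\<close>-th term of
  a filtration of \<open>G\<close> form a group for every \<open>i \<ge> 1\<close> (Lazard and Leibman). Among them, those with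
  \<open>f(0) = 1\<close> give a chain \<open>N\<^sub>0 \<supseteq> N\<^sub>1 \<supseteq> \<dots>\<close> of normal subgroups that ends in the trivial group, and
  \<open>f \<in> N\<^sub>i\<close> agrees modulo \<open>N\<^bsub>i+1\<^esub>\<close> with \<open>m \<mapsto> f(n)\<^sup>-\<^sup>1 f(m + n)\<close>. Counting cosets along this chain
  gives the weight of a PET induction which shows that finitely many distinct nontrivial sequences
  move points from \<open>V\<close> into prescribed open sets at a common time.

  If no \<open>t \<noteq> 0\<close> satisfies \<open>g(m + t) = g(t) g(m)\<close> for all \<open>m\<close>, this applies to the shifts
  \<open>m \<mapsto> g(i)\<^sup>-\<^sup>1 g(m + i)\<close>, \<open>0 \<le> i \<le> L\<close>, so that generic points visit \<open>U\<close> along a thick set of times.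
  If such a \<open>t\<close> exists, minimality of \<open>g(t)\<close> makes the visits of every point syndetic.
\<close>

section \<open>Polynomial sequences in filtered groups\<close>

text \<open>In a noncommutative group a sequence has no leading coefficient; its class modulo the
  next term of the chain plays that part in the weight. The induction step translates a starting
  point by the inverse of some \<open>p m\<close>, and the translate must be brought back into a
  prescribed open set by a map that commutes with every sequence in play. A nontrivial central
  element does this, and its minimality bounds the exponents needed. The step also needs shifts
  whose constraints are compatible with one another. Finding them is again a simultaneous return
  problem of the same weight, though for one sequence at a time (\<open>singly\<close>). It is
  reduced to smaller weight by dividing each sequence by itself, with pairwise distinct shifts.
  Sequences with \<open>f (m + t) = f t \<otimes> f m\<close> have coinciding shifts and escape
  this; along multiples of \<open>t\<close> they are powers of \<open>f t\<close>, for which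
  Furstenberg's filter argument works directly. That \<open>f t \<noteq> \<one>\<close> rests on the
  group being torsion free, which minimality and weak mixing force as soon as the space has two
  points.\<close>

definition (in monoid) comm :: "'a \<Rightarrow> 'a \<Rightarrow> 'a" where
  "comm x y = x \<otimes> y \<otimes> inv x \<otimes> inv y"

context group
begin

lemma inv_mult_cancel [simp]:
  assumes "x \<in> carrier G" "y \<in> carrier G"
  shows "inv x \<otimes> (x \<otimes> y) = y" "x \<otimes> (inv x \<otimes> y) = y"
  using assms by (simp_all flip: m_assoc)

lemma comm_closed [simp]: "x \<in> carrier G \<Longrightarrow> y \<in> carrier G \<Longrightarrow> comm x y \<in> carrier G"
  by (simp add: comm_def)

lemma inv_comm: "x \<in> carrier G \<Longrightarrow> y \<in> carrier G \<Longrightarrow> inv (comm x y) = comm y x"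
  by (simp add: comm_def inv_mult_group m_assoc)

lemma comm_eq_one_iff:
  assumes "x \<in> carrier G" "y \<in> carrier G"
  shows "comm x y = \<one> \<longleftrightarrow> x \<otimes> y = y \<otimes> x"
proof -
  have "comm x y = (x \<otimes> y) \<otimes> inv (y \<otimes> x)"
    using assms by (simp add: comm_def inv_mult_group m_assoc)
  then show ?thesis
    using assms by (metis inv_equality inv_inv m_closed r_inv inv_closed)
qed

text \<open>Models a simultaneous shift of two sequences: \<open>a\<close> and \<open>b\<close> are
  the differences, put at the outer ends so that each cancels once it commutes with what it has to
  pass.\<close>

lemma comm_mult_commuting:
  assumes "a \<in> carrier G" "g \<in> carrier G" "h \<in> carrier G" "b \<in> carrier G"
    and ag: "a \<otimes> g = g \<otimes> a" and ah: "a \<otimes> h = h \<otimes> a" and ab: "a \<otimes> b = b \<otimes> a"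
    and gb: "g \<otimes> b = b \<otimes> g"
  shows "comm (a \<otimes> g) (h \<otimes> b) = comm g h"
proof -
  note cl = assms(1-4)
  have 1: "g \<otimes> (h \<otimes> b) \<otimes> inv g = g \<otimes> h \<otimes> inv g \<otimes> b"
  proof -
    have "b \<otimes> inv g = inv g \<otimes> b"
      using gb cl by (metis inv_mult_cancel(1) inv_solve_right' m_assoc m_closed inv_closed)
    then show ?thesis using cl by (simp add: m_assoc)
  qed
  have 2: "a \<otimes> (g \<otimes> (h \<otimes> b)) = g \<otimes> (h \<otimes> b) \<otimes> a"
    using cl ag ah ab by (metis m_assoc m_closed)
  have "comm (a \<otimes> g) (h \<otimes> b) = a \<otimes> (g \<otimes> (h \<otimes> b)) \<otimes> inv g \<otimes> inv a \<otimes> inv (h \<otimes> b)"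
  proof -
    have "a \<otimes> g \<otimes> (h \<otimes> b) \<otimes> (inv g \<otimes> inv a) \<otimes> inv (h \<otimes> b)
      = a \<otimes> (g \<otimes> (h \<otimes> b)) \<otimes> inv g \<otimes> inv a \<otimes> inv (h \<otimes> b)"
      using cl by (simp add: m_assoc)
    then show ?thesis using cl by (simp add: comm_def inv_mult_group)
  qed
  also have "\<dots> = g \<otimes> (h \<otimes> b) \<otimes> (a \<otimes> inv g \<otimes> inv a) \<otimes> inv (h \<otimes> b)"
    unfolding 2 using cl by (simp add: m_assoc)
  also have "a \<otimes> inv g \<otimes> inv a = inv g"
  proof -
    have "a \<otimes> inv g = inv g \<otimes> a"
      using ag cl by (metis inv_mult_cancel(1) inv_solve_right' m_assoc m_closed inv_closed)
    then show ?thesis using cl by (simp add: m_assoc)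
  qed
  also have "g \<otimes> (h \<otimes> b) \<otimes> inv g \<otimes> inv (h \<otimes> b) = comm g h"
    unfolding 1 using cl by (simp add: comm_def inv_mult_group m_assoc)
  finally show ?thesis .
qed

text \<open>The preceding identity modulo \<open>N\<close>. Only the four given elements are known
  to normalise \<open>N\<close>, so the quotient is formed inside the normaliser of
  \<open>N\<close>, where commutators in \<open>N\<close> become commuting images. The two
  conclusions serve the two one-sided differences.\<close>

lemma comm_mult_mod:
  assumes N: "subgroup N G"
    and cl: "a \<in> carrier G" "g \<in> carrier G" "h \<in> carrier G" "b \<in> carrier G"
    and nrm: "\<And>u x. u \<in> {a, g, h, b} \<Longrightarrow> x \<in> N \<Longrightarrow> u \<otimes> x \<otimes> inv u \<in> N \<and> inv u \<otimes> x \<otimes> u \<in> N"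
    and cm: "comm a g \<in> N" "comm a h \<in> N" "comm a b \<in> N" "comm g b \<in> N"
  shows "comm (a \<otimes> g) (h \<otimes> b) \<otimes> inv (comm g h) \<in> N"
    and "inv (comm g h) \<otimes> comm (a \<otimes> g) (h \<otimes> b) \<in> N"
proof -
  interpret N: subgroup N G by (rule N)
  \<comment> \<open>Normalising in both directions makes \<open>K\<close> closed under inverses at
    once.\<close>
  define K where "K = {u \<in> carrier G. \<forall>x\<in>N. u \<otimes> x \<otimes> inv u \<in> N \<and> inv u \<otimes> x \<otimes> u \<in> N}"
  have K: "subgroup K G"
  proof
    show "K \<subseteq> carrier G" by (auto simp: K_def)
    show "\<one> \<in> K" using N.subset by (auto simp: K_def)
    fix x assume x: "x \<in> K" then show "inv x \<in> K" by (auto simp: K_def)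
    fix y assume y: "y \<in> K"
    have "(x \<otimes> y) \<otimes> z \<otimes> inv (x \<otimes> y) = x \<otimes> (y \<otimes> z \<otimes> inv y) \<otimes> inv x"
      "inv (x \<otimes> y) \<otimes> z \<otimes> (x \<otimes> y) = inv y \<otimes> (inv x \<otimes> z \<otimes> x) \<otimes> y" if "z \<in> N" for z
      using x y that N.mem_carrier[OF that] by (simp_all add: K_def inv_mult_group m_assoc)
    then show "x \<otimes> y \<in> K" using x y by (auto simp: K_def)
  qed
  interpret K: group "G\<lparr>carrier := K\<rparr>" by (rule subgroup.subgroup_is_group[OF K is_group])
  have NK: "N \<subseteq> K" using N.m_closed N.m_inv_closed N.subset by (auto simp: K_def)
  have invK: "inv\<^bsub>G\<lparr>carrier := K\<rparr>\<^esub> x = inv x" if "x \<in> K" for x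
    using that K m_inv_consistent by blast
  have nK: "normal N (G\<lparr>carrier := K\<rparr>)"
  proof (rule K.normal_invI)
    show "subgroup N (G\<lparr>carrier := K\<rparr>)"
      using subgroup_incl[OF N K NK] .
    show "x \<otimes>\<^bsub>G\<lparr>carrier := K\<rparr>\<^esub> h \<otimes>\<^bsub>G\<lparr>carrier := K\<rparr>\<^esub> inv\<^bsub>G\<lparr>carrier := K\<rparr>\<^esub> x \<in> N"
      if "x \<in> carrier (G\<lparr>carrier := K\<rparr>)" "h \<in> N" for x h
      using that invK[of x] by (simp add: K_def)
  qed
  define \<pi> where "\<pi> = (\<lambda>x. N #>\<^bsub>G\<lparr>carrier := K\<rparr>\<^esub> x)"
  define Q where "Q = G\<lparr>carrier := K\<rparr> Mod N"
  have "group Q" unfolding Q_def by (rule normal.factorgroup_is_group[OF nK])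
  have hom: "\<pi> \<in> hom (G\<lparr>carrier := K\<rparr>) Q"
    unfolding \<pi>_def Q_def by (rule normal.r_coset_hom_Mod[OF nK])
  interpret \<pi>: group_hom "G\<lparr>carrier := K\<rparr>" Q \<pi>
    by (intro group_hom.intro group_hom_axioms.intro K.group_axioms \<open>group Q\<close> hom)
  have \<pi>1: "\<pi> x = \<one>\<^bsub>Q\<^esub> \<longleftrightarrow> x \<in> N" if "x \<in> K" for x
    using that K.coset_join1[of N x] K.coset_join2[of x N] normal_imp_subgroup[OF nK]
      subgroup.subset[OF normal_imp_subgroup[OF nK]]
    unfolding \<pi>_def Q_def by (auto simp: FactGroup_def)
  have Kc: "a \<in> K" "g \<in> K" "h \<in> K" "b \<in> K"
    using nrm cl by (auto simp: K_def)
  have Km: "x \<otimes> y \<in> K" "\<pi> (x \<otimes> y) = \<pi> x \<otimes>\<^bsub>Q\<^esub> \<pi> y" if "x \<in> K" "y \<in> K" for x y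
    using that subgroup.m_closed[OF K] \<pi>.hom_mult[of x y] by auto
  have Ki: "inv x \<in> K" "\<pi> (inv x) = inv\<^bsub>Q\<^esub> \<pi> x" "\<pi> x \<in> carrier Q" if "x \<in> K" for x
    using that subgroup.m_inv_closed[OF K] \<pi>.hom_inv[of x] invK[of x] \<pi>.hom_closed[of x] by auto
  note Km = Km Ki
  have cK: "comm x y \<in> K" "\<pi> (comm x y) = monoid.comm Q (\<pi> x) (\<pi> y)" if "x \<in> K" "y \<in> K" for x y
    using that Km by (simp_all add: comm_def \<pi>.H.comm_def)
  have com: "\<pi> x \<otimes>\<^bsub>Q\<^esub> \<pi> y = \<pi> y \<otimes>\<^bsub>Q\<^esub> \<pi> x" if "comm x y \<in> N" "x \<in> K" "y \<in> K" for x y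
    using that cK[of x y] \<pi>1[of "comm x y"] \<pi>.H.comm_eq_one_iff Km by metis
  have eq: "\<pi> (comm (a \<otimes> g) (h \<otimes> b)) = \<pi> (comm g h)"
    using \<pi>.H.comm_mult_commuting[of "\<pi> a" "\<pi> g" "\<pi> h" "\<pi> b"]
      com[OF cm(1)] com[OF cm(2)] com[OF cm(3)] com[OF cm(4)] Kc
    by (simp add: cK Km)
  show "comm (a \<otimes> g) (h \<otimes> b) \<otimes> inv (comm g h) \<in> N"
    "inv (comm g h) \<otimes> comm (a \<otimes> g) (h \<otimes> b) \<in> N"
    using \<pi>1[of "comm (a \<otimes> g) (h \<otimes> b) \<otimes> inv (comm g h)"]
      \<pi>1[of "inv (comm g h) \<otimes> comm (a \<otimes> g) (h \<otimes> b)"] by (simp_all add: eq Km cK Kc)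
qed

end

section \<open>Sequences under pointwise multiplication and their differences\<close>

definition fun_group :: "('a, 'm) monoid_scheme \<Rightarrow> (int \<Rightarrow> 'a) monoid" where
  "fun_group G = \<lparr>carrier = {f. \<forall>n. f n \<in> carrier G},
     monoid.mult = (\<lambda>f g n. f n \<otimes>\<^bsub>G\<^esub> g n), one = (\<lambda>_. \<one>\<^bsub>G\<^esub>)\<rparr>"

context group
begin

lemma carrier_fun_group: "f \<in> carrier (fun_group G) \<longleftrightarrow> (\<forall>n. f n \<in> carrier G)"
  by (simp add: fun_group_def)

lemma mult_fun_group [simp]: "(f \<otimes>\<^bsub>fun_group G\<^esub> g) n = f n \<otimes> g n"
  by (simp add: fun_group_def)

lemma one_fun_group [simp]: "\<one>\<^bsub>fun_group G\<^esub> n = \<one>"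
  by (simp add: fun_group_def)

lemma group_fun_group: "group (fun_group G)"
proof (rule groupI)
  show "\<exists>y\<in>carrier (fun_group G). y \<otimes>\<^bsub>fun_group G\<^esub> x = \<one>\<^bsub>fun_group G\<^esub>"
    if "x \<in> carrier (fun_group G)" for x
    using that by (intro bexI[of _ "\<lambda>n. inv (x n)"]) (auto simp: carrier_fun_group)
qed (auto simp: carrier_fun_group m_assoc)

interpretation F: group "fun_group G"
  by (rule group_fun_group)

lemma inv_fun_group: 
  assumes "f \<in> carrier (fun_group G)"
  shows "inv\<^bsub>fun_group G\<^esub> f = (\<lambda>n. inv (f n))"
  by (rule F.inv_equality) (use assms in \<open>auto simp: carrier_fun_group\<close>)

lemma inv_fun_group_apply [simp]: 
  "f \<in> carrier (fun_group G) \<Longrightarrow> (inv\<^bsub>fun_group G\<^esub> f) n = inv (f n)"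
  by (simp add: inv_fun_group)

lemma comm_fun_group [simp]:
  assumes "f \<in> carrier (fun_group G)" "g \<in> carrier (fun_group G)"
  shows "F.comm f g n = comm (f n) (g n)"
  using assms by (simp add: F.comm_def comm_def)

text \<open>Both one-sided difference operators, since neither alone makes the commutator estimate below
  close up.\<close>

fun diff :: "bool \<times> int \<Rightarrow> (int \<Rightarrow> 'a) \<Rightarrow> int \<Rightarrow> 'a" where
  "diff (l, t) f n = (if l then f (n + t) \<otimes> inv (f n) else inv (f n) \<otimes> f (n + t))"

lemma diff_closed [simp]: "f \<in> carrier (fun_group G) \<Longrightarrow> diff t f \<in> carrier (fun_group G)"
  by (cases t) (auto simp: carrier_fun_group)

end

section \<open>The Lazard-Leibman theorem for filtered groups\<close>

locale filtered_group = group G for G (structure) +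
  fixes H :: "nat \<Rightarrow> 'a set" and M :: nat
  assumes H_subgroup: "subgroup (H i) G"
    and H_Suc: "H (Suc i) \<subseteq> H i"
    and H_comm: "a \<in> H i \<Longrightarrow> b \<in> H j \<Longrightarrow> comm a b \<in> H (i + j)"
    and H_trivial: "M \<le> i \<Longrightarrow> H i = {\<one>}"
begin

interpretation F: group "fun_group G"
  by (rule group_fun_group)

definition polyseq :: "nat \<Rightarrow> (int \<Rightarrow> 'a) set" where
  "polyseq i = {f. \<forall>ts n. fold diff ts f n \<in> H (i + length ts)}"

lemma H_closed: "a \<in> H i \<Longrightarrow> a \<in> carrier G"
  by (rule subgroup.mem_carrier[OF H_subgroup])

lemma polyseqD: "f \<in> polyseq i \<Longrightarrow> fold diff ts f n \<in> H (i + length ts)"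
  by (simp add: polyseq_def)

lemma polyseq_value: "f \<in> polyseq i \<Longrightarrow> f n \<in> H i"
  using polyseqD[of f i "[]" n] by simp

lemma diff_polyseq:
  assumes "f \<in> polyseq i" 
  shows "diff t f \<in> polyseq (Suc i)"
  using polyseqD[OF assms, of "t # _"] by (simp add: polyseq_def del: diff.simps)

lemma polyseqI:
  assumes "\<And>n. f n \<in> H i" "\<And>t. diff t f \<in> polyseq (Suc i)"
  shows "f \<in> polyseq i"
proof -
  have "fold diff ts f n \<in> H (i + length ts)" for ts n
  proof (cases ts)
    case Nil
    then show ?thesis using assms(1) by simp
  next
    case (Cons t ts')
    then show ?thesis using polyseqD[OF assms(2), of ts' t n] by simp
  qed
  then show ?thesis by (simp add: polyseq_def)
qed

lemma polyseq_Suc: "polyseq (Suc i) \<subseteq> polyseq i"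
proof
  fix f assume "f \<in> polyseq (Suc i)"
  then have "fold diff ts f n \<in> H (Suc (i + length ts))" for ts n
    unfolding polyseq_def by simp
  then show "f \<in> polyseq i"
    unfolding polyseq_def using H_Suc by blast
qed

lemma polyseq_mono: "i \<le> j \<Longrightarrow> polyseq j \<subseteq> polyseq i"
proof (induction j rule: dec_induct)
  case (step j)
  then show ?case using polyseq_Suc[of j] by blast
qed simp

lemma polyseq_closed: "f \<in> polyseq i \<Longrightarrow> f \<in> carrier (fun_group G)"
  using polyseq_value H_closed unfolding carrier_fun_group by blast

lemma diff_one [simp]: "diff t (\<lambda>_. \<one>) = (\<lambda>_. \<one>)"
  by (cases t) auto

lemma one_polyseq: "(\<lambda>_. \<one>) \<in> polyseq i"
proof -
  have "fold diff ts (\<lambda>_. \<one>) = (\<lambda>_. \<one>)" for ts by (induction ts) auto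
  then show ?thesis unfolding polyseq_def using subgroup.one_closed[OF H_subgroup] by auto
qed

lemma const_polyseq: "c \<in> H i \<Longrightarrow> (\<lambda>_. c) \<in> polyseq i"
proof (rule polyseqI)
  fix t assume c: "c \<in> H i"
  have "diff t (\<lambda>_. c) = (\<lambda>_. \<one>)" using H_closed[OF c] by (cases t) auto
  then show "diff t (\<lambda>_. c) \<in> polyseq (Suc i)" using one_polyseq by simp
qed

lemma polyseq_trivial: "M \<le> i \<Longrightarrow> polyseq i = {\<lambda>_. \<one>}"
proof (intro equalityI subsetI)
  fix f assume "M \<le> i" "f \<in> polyseq i"
  then have "f n = \<one>" for n using polyseq_value[of f i n] H_trivial[of i] by simp
  then show "f \<in> {\<lambda>_. \<one>}" by auto
qed (simp add: one_polyseq)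

lemma subgroup_polyseq_trivial: "M \<le> i \<Longrightarrow> subgroup (polyseq i) (fun_group G)"
  using F.triv_subgroup by (simp add: polyseq_trivial fun_group_def)

text \<open>That a level is a group and that commutators of levels add their indices depend on each
  other, and both are proved by descending induction. The predicate isolates the second claim for
  one pair of levels so that it can serve as an induction hypothesis.\<close>

definition comm_ok :: "nat \<Rightarrow> nat \<Rightarrow> bool" where
  "comm_ok i j \<longleftrightarrow> (\<forall>g\<in>polyseq i. \<forall>h\<in>polyseq j. F.comm g h \<in> polyseq (i + j))"

lemma conj_polyseq1:
  assumes "\<And>m'. m' \<ge> m \<Longrightarrow> subgroup (polyseq m') (fun_group G)" "comm_ok i m" 
    and g: "g \<in> polyseq i" and y: "y \<in> polyseq m"
  shows "g \<otimes>\<^bsub>fun_group G\<^esub> y \<otimes>\<^bsub>fun_group G\<^esub> inv\<^bsub>fun_group G\<^esub> g \<in> polyseq m"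
proof -
  have c: "g \<in> carrier (fun_group G)" "y \<in> carrier (fun_group G)" using g y polyseq_closed by auto
  have "F.comm g y \<in> polyseq m"
    using assms unfolding comm_ok_def using polyseq_mono[of m "i + m"] by auto
  then have "F.comm g y \<otimes>\<^bsub>fun_group G\<^esub> y \<in> polyseq m"
    using assms(1)[of m] y subgroup.m_closed by fastforce
  also have "F.comm g y \<otimes>\<^bsub>fun_group G\<^esub> y = g \<otimes>\<^bsub>fun_group G\<^esub> y \<otimes>\<^bsub>fun_group G\<^esub> inv\<^bsub>fun_group G\<^esub> g"
    using c by (simp add: F.comm_def F.m_assoc)
  finally show ?thesis .
qed

text \<open>Since \<open>inv g \<otimes> y \<otimes> g\<close> is the conjugate of the inverse of
  \<open>comm g y\<close>, again by \<open>inv g\<close>, times \<open>y\<close>, the problem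
  reproduces itself one level deeper (\<open>1 \<le> i\<close>). Hence the induction on
  \<open>M - m\<close>; conjugation in the other direction needs none.\<close>

lemma conj_polyseq2:
  assumes "\<And>m'. m' \<ge> m \<Longrightarrow> subgroup (polyseq m') (fun_group G)" "\<And>m'. m' \<ge> m \<Longrightarrow> comm_ok i m'"
    and "1 \<le> i" and g: "g \<in> polyseq i" and y: "y \<in> polyseq m"
  shows "inv\<^bsub>fun_group G\<^esub> g \<otimes>\<^bsub>fun_group G\<^esub> y \<otimes>\<^bsub>fun_group G\<^esub> g \<in> polyseq m"
  using assms
proof (induction "M - m" arbitrary: m y rule: less_induct)
  case less
  let ?F = "fun_group G"
  have c: "g \<in> carrier ?F" "y \<in> carrier ?F" using less.prems polyseq_closed by auto
  show ?case
  proof (cases "M \<le> m")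
    case True
    then have "y = \<one>\<^bsub>?F\<^esub>" using less.prems(5) polyseq_trivial by (auto simp: fun_group_def)
    then have "inv\<^bsub>?F\<^esub> g \<otimes>\<^bsub>?F\<^esub> y \<otimes>\<^bsub>?F\<^esub> g = \<one>\<^bsub>?F\<^esub>" using c by simp
    then show ?thesis using one_polyseq by (simp add: fun_group_def)
  next
    case False
    have "F.comm g y \<in> polyseq (i + m)"
      using less.prems unfolding comm_ok_def by auto
    then have "F.comm g y \<in> polyseq (Suc m)" using polyseq_mono[of "Suc m" "i + m"] less.prems(3) by auto
    then have "inv\<^bsub>?F\<^esub> (F.comm g y) \<in> polyseq (Suc m)"
      using less.prems(1)[of "Suc m"] subgroup.m_inv_closed by fastforce
    then have "inv\<^bsub>?F\<^esub> g \<otimes>\<^bsub>?F\<^esub> inv\<^bsub>?F\<^esub> (F.comm g y) \<otimes>\<^bsub>?F\<^esub> g \<in> polyseq (Suc m)"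
      using less.prems False by (intro less.hyps) auto
    then have "(inv\<^bsub>?F\<^esub> g \<otimes>\<^bsub>?F\<^esub> inv\<^bsub>?F\<^esub> (F.comm g y) \<otimes>\<^bsub>?F\<^esub> g) \<otimes>\<^bsub>?F\<^esub> y \<in> polyseq m"
      using subgroup.m_closed[OF less.prems(1)[OF order_refl] _ less.prems(5)] polyseq_Suc by blast
    also have "(inv\<^bsub>?F\<^esub> g \<otimes>\<^bsub>?F\<^esub> inv\<^bsub>?F\<^esub> (F.comm g y) \<otimes>\<^bsub>?F\<^esub> g) \<otimes>\<^bsub>?F\<^esub> y = inv\<^bsub>?F\<^esub> g \<otimes>\<^bsub>?F\<^esub> y \<otimes>\<^bsub>?F\<^esub> g"
      using c by (simp add: F.comm_def F.m_assoc F.inv_mult_group)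
    finally show ?thesis .
  qed
qed

text \<open>Leibniz rules. Each leaves one difference conjugated by a sequence of the original
  level, which keeps it in the next level.\<close>

lemma diff_mult:
  assumes "f \<in> carrier (fun_group G)" "g \<in> carrier (fun_group G)"
  shows "diff (True, t) (f \<otimes>\<^bsub>fun_group G\<^esub> g) = diff (True, t) f \<otimes>\<^bsub>fun_group G\<^esub>
      (f \<otimes>\<^bsub>fun_group G\<^esub> diff (True, t) g \<otimes>\<^bsub>fun_group G\<^esub> inv\<^bsub>fun_group G\<^esub> f)"
    and "diff (False, t) (f \<otimes>\<^bsub>fun_group G\<^esub> g) = 
      (inv\<^bsub>fun_group G\<^esub> g \<otimes>\<^bsub>fun_group G\<^esub> diff (False, t) f \<otimes>\<^bsub>fun_group G\<^esub> g) \<otimes>\<^bsub>fun_group G\<^esub> diff (False, t) g"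
  using assms by (auto simp: fun_eq_iff inv_mult_group m_assoc carrier_fun_group)

lemma diff_inv:
  assumes "f \<in> carrier (fun_group G)"
  shows "diff (True, t) (inv\<^bsub>fun_group G\<^esub> f) = 
      inv\<^bsub>fun_group G\<^esub> f \<otimes>\<^bsub>fun_group G\<^esub> inv\<^bsub>fun_group G\<^esub> (diff (True, t) f) \<otimes>\<^bsub>fun_group G\<^esub> f"
    and "diff (False, t) (inv\<^bsub>fun_group G\<^esub> f) = 
      f \<otimes>\<^bsub>fun_group G\<^esub> inv\<^bsub>fun_group G\<^esub> (diff (False, t) f) \<otimes>\<^bsub>fun_group G\<^esub> inv\<^bsub>fun_group G\<^esub> f"
proof -
  have "f n \<in> carrier G" for n using assms by (simp add: carrier_fun_group)
  then show "diff (True, t) (inv\<^bsub>fun_group G\<^esub> f) = 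
      inv\<^bsub>fun_group G\<^esub> f \<otimes>\<^bsub>fun_group G\<^esub> inv\<^bsub>fun_group G\<^esub> (diff (True, t) f) \<otimes>\<^bsub>fun_group G\<^esub> f"
   "diff (False, t) (inv\<^bsub>fun_group G\<^esub> f) = 
      f \<otimes>\<^bsub>fun_group G\<^esub> inv\<^bsub>fun_group G\<^esub> (diff (False, t) f) \<otimes>\<^bsub>fun_group G\<^esub> inv\<^bsub>fun_group G\<^esub> f"
    using assms by (auto simp: fun_eq_iff inv_mult_group m_assoc)
qed

text \<open>The differences in the Leibniz rules are conjugates of members of level
  \<open>Suc m\<close> by members of level \<open>m\<close>. This calls for commutators of index sum
  at least \<open>2 * m + 1\<close>, which explains the bound \<open>n \<le> 2 * m\<close>.\<close>

lemma subgroup_polyseq_step: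
  assumes "\<And>i j. 1 \<le> i \<Longrightarrow> 1 \<le> j \<Longrightarrow> n < i + j \<Longrightarrow> comm_ok i j"
  shows "n \<le> 2 * m \<Longrightarrow> 1 \<le> m \<Longrightarrow> subgroup (polyseq m) (fun_group G)"
proof (induction "M - m" arbitrary: m rule: less_induct)
  case less
  let ?F = "fun_group G"
  show ?case
  proof (cases "M \<le> m")
    case True
    then show ?thesis by (rule subgroup_polyseq_trivial)
  next
    case False
    have sub: "subgroup (polyseq m') ?F" if "m < m'" for m'
      using less False that by (cases "M \<le> m'") (auto simp: subgroup_polyseq_trivial)
    have conj: "g \<otimes>\<^bsub>?F\<^esub> y \<otimes>\<^bsub>?F\<^esub> inv\<^bsub>?F\<^esub> g \<in> polyseq (Suc m)" "inv\<^bsub>?F\<^esub> g \<otimes>\<^bsub>?F\<^esub> y \<otimes>\<^bsub>?F\<^esub> g \<in> polyseq (Suc m)"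
      if "g \<in> polyseq m" "y \<in> polyseq (Suc m)" for g y
      using that less.prems sub assms by (auto intro!: conj_polyseq1[where i = m] conj_polyseq2[where i = m])
    note Suc_closed = subgroup.m_closed[OF sub[OF lessI]] subgroup.m_inv_closed[OF sub[OF lessI]]
    show ?thesis
    proof
      show "polyseq m \<subseteq> carrier ?F" using polyseq_closed by blast
      show "\<one>\<^bsub>?F\<^esub> \<in> polyseq m" using one_polyseq by (simp add: fun_group_def)
      fix f assume f: "f \<in> polyseq m"
      then have fc: "f \<in> carrier ?F" using polyseq_closed by blast
      show "inv\<^bsub>?F\<^esub> f \<in> polyseq m"
        
      proof (rule polyseqI)
        show "(inv\<^bsub>?F\<^esub> f) n \<in> H m" for n
          using fc polyseq_value[OF f] subgroup.m_inv_closed[OF H_subgroup] by simp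
        fix s :: "bool \<times> int"
        obtain l t where s: "s = (l, t)" by force
        show "diff s (inv\<^bsub>?F\<^esub> f) \<in> polyseq (Suc m)"
          unfolding s by (cases l; simp only: diff_inv[OF fc]) (intro conj Suc_closed diff_polyseq f)+
      qed
      fix g assume g: "g \<in> polyseq m"
      then have gc: "g \<in> carrier ?F" using polyseq_closed by blast
      show "f \<otimes>\<^bsub>?F\<^esub> g \<in> polyseq m"
        
      proof (rule polyseqI)
        show "(f \<otimes>\<^bsub>?F\<^esub> g) n \<in> H m" for n
          using polyseq_value[OF f] polyseq_value[OF g] subgroup.m_closed[OF H_subgroup] by simp
        fix s :: "bool \<times> int"
        obtain l t where s: "s = (l, t)" by force
        show "diff s (f \<otimes>\<^bsub>?F\<^esub> g) \<in> polyseq (Suc m)"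
          unfolding s by (cases l; simp only: diff_mult[OF fc gc]) (intro conj Suc_closed diff_polyseq f g)+
      qed
    qed
  qed
qed

text \<open>A difference of a commutator is a quotient of two commutators, and these agree modulo
  level \<open>Suc n\<close> by \<open>comm_mult_mod\<close>.\<close>

lemma comm_ok_step:
  assumes step: "\<And>i j. 1 \<le> i \<Longrightarrow> 1 \<le> j \<Longrightarrow> n < i + j \<Longrightarrow> comm_ok i j"
    and ij: "1 \<le> j" "j \<le> i" "i + j = n"
  shows "comm_ok i j"
  unfolding comm_ok_def
proof safe
  let ?F = "fun_group G"
  fix g h assume g: "g \<in> polyseq i" and h: "h \<in> polyseq j"
  have sub: "subgroup (polyseq m) ?F" if "n \<le> 2 * m" "1 \<le> m" for m
    by (rule subgroup_polyseq_step[OF _ that]) (rule step)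
  have gh: "g \<in> carrier ?F" "h \<in> carrier ?F" using g h polyseq_closed by auto
  show "F.comm g h \<in> polyseq (i + j)"
    
  proof (rule polyseqI)
    show "F.comm g h n \<in> H (i + j)" for n
      using g h gh by (simp add: H_comm polyseq_value)
    fix s :: "bool \<times> int"
    obtain l t where s: "s = (l, t)" by force
    define N where "N = polyseq (Suc n)"
    define a where "a = diff (True, t) g"
    define b where "b = diff (False, t) h"
    have N: "subgroup N ?F" unfolding N_def using ij by (intro sub) auto
    have a: "a \<in> polyseq (Suc i)" and b: "b \<in> polyseq (Suc j)"
      unfolding a_def b_def using g h diff_polyseq by auto
    have ab: "a \<in> carrier ?F" "b \<in> carrier ?F" using a b polyseq_closed by auto
    have nrm: "u \<otimes>\<^bsub>?F\<^esub> x \<otimes>\<^bsub>?F\<^esub> inv\<^bsub>?F\<^esub> u \<in> N \<and> inv\<^bsub>?F\<^esub> u \<otimes>\<^bsub>?F\<^esub> x \<otimes>\<^bsub>?F\<^esub> u \<in> N"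
      if "u \<in> {a, g, h, b}" "x \<in> N" for u x
    proof -
      have "u \<in> polyseq 1"
        using that(1) a b g h ij polyseq_mono[of 1 i] polyseq_mono[of 1 j] polyseq_mono[of 1 "Suc i"]
          polyseq_mono[of 1 "Suc j"] by auto
      moreover have "subgroup (polyseq m') ?F \<and> comm_ok 1 m'" if "m' \<ge> Suc n" for m'
        using that ij by (auto intro!: sub step)
      ultimately show ?thesis
        using conj_polyseq1[of "Suc n" 1 u x] conj_polyseq2[of "Suc n" 1 u x] that(2) unfolding N_def by simp
    qed
    \<comment> \<open>The pair \<open>a\<close>, \<open>g\<close> comes from \<open>g\<close> alone
      and has index sum \<open>2 * i + 1\<close>; this reaches \<open>Suc n\<close> only because
      \<open>j \<le> i\<close>.\<close>
    have "N = polyseq (Suc i + j)" "N = polyseq (i + Suc j)" "polyseq (Suc i + i) \<subseteq> N" "polyseq (Suc i + Suc j) \<subseteq> N"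
      unfolding N_def using ij by (auto intro!: polyseq_mono simp del: subsetI)
    moreover have "comm_ok (Suc i) i" "comm_ok (Suc i) j" "comm_ok (Suc i) (Suc j)" "comm_ok i (Suc j)"
      using ij by (auto intro: step)
    ultimately have cm: "F.comm a g \<in> N" "F.comm a h \<in> N" "F.comm a b \<in> N" "F.comm g b \<in> N"
      unfolding comm_ok_def using a b g h by blast+
    \<comment> \<open>Taking the left difference of \<open>g\<close> and the right difference of
      \<open>h\<close> puts \<open>a\<close> and \<open>b\<close> at the outer ends, as
      \<open>comm_mult_mod\<close> requires.\<close>
    have shift: "a n \<otimes> g n = g (n + t)" "h n \<otimes> b n = h (n + t)" for n
      using gh unfolding a_def b_def carrier_fun_group by (simp_all add: m_assoc)
    have ag: "a \<otimes>\<^bsub>?F\<^esub> g \<in> carrier ?F" "h \<otimes>\<^bsub>?F\<^esub> b \<in> carrier ?F" "F.comm g h \<in> carrier ?F"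
      using gh ab by auto
    have "diff (True, t) (F.comm g h) = F.comm (a \<otimes>\<^bsub>?F\<^esub> g) (h \<otimes>\<^bsub>?F\<^esub> b) \<otimes>\<^bsub>?F\<^esub> inv\<^bsub>?F\<^esub> (F.comm g h)"
      by (rule ext, simp only: mult_fun_group comm_fun_group[OF ag(1,2)] inv_fun_group_apply[OF ag(3)] shift)
        (simp add: gh)
    moreover have "diff (False, t) (F.comm g h) = inv\<^bsub>?F\<^esub> (F.comm g h) \<otimes>\<^bsub>?F\<^esub> F.comm (a \<otimes>\<^bsub>?F\<^esub> g) (h \<otimes>\<^bsub>?F\<^esub> b)"
      by (rule ext, simp only: mult_fun_group comm_fun_group[OF ag(1,2)] inv_fun_group_apply[OF ag(3)] shift)
        (simp add: gh)
    ultimately show "diff s (F.comm g h) \<in> polyseq (Suc (i + j))"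
      using F.comm_mult_mod[OF N ab(1) gh ab(2) nrm cm] ij unfolding s
      by (cases l) (simp_all add: N_def del: diff.simps)
  qed
qed

text \<open>Descends on \<open>i + j\<close>, starting where the filtration is trivial. The case
  \<open>i < j\<close> follows from the other by inverting the commutator.\<close>

lemma comm_ok: "1 \<le> i \<Longrightarrow> 1 \<le> j \<Longrightarrow> comm_ok i j"
proof (induction "M - (i + j)" arbitrary: i j rule: less_induct)
  case less
  let ?F = "fun_group G"
  have *: "comm_ok i j" if "1 \<le> i" "1 \<le> j" "M \<le> i + j" for i j
    unfolding comm_ok_def
  proof safe
    fix g h assume g: "g \<in> polyseq i" and h: "h \<in> polyseq j"
    have gh: "g \<in> carrier ?F" "h \<in> carrier ?F" using g h polyseq_closed by auto
    have "F.comm g h n = \<one>" for n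
      using H_comm[OF polyseq_value[OF g] polyseq_value[OF h], of n n] gh H_trivial[of "i + j"] that by simp
    then have "F.comm g h = (\<lambda>_. \<one>)" by blast
    then show "F.comm g h \<in> polyseq (i + j)" using one_polyseq by simp
  qed
  have step: "comm_ok i' j'" if "1 \<le> i'" "1 \<le> j'" "i + j < i' + j'" for i' j'
    using less.hyps[of i' j'] * that by (cases "M \<le> i' + j'") auto
  show ?case
  proof (cases "j \<le> i")
    case True
    then show ?thesis using comm_ok_step[of "i + j" j i] step less.prems by blast
  next
    case False
    then have ji: "comm_ok j i" using comm_ok_step[of "i + j" i j] step less.prems by (simp add: add.commute)
    show ?thesis
      unfolding comm_ok_def
    proof safe
      fix g h assume g: "g \<in> polyseq i" and h: "h \<in> polyseq j"
      have gh: "g \<in> carrier ?F" "h \<in> carrier ?F" using g h polyseq_closed by auto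
      have "subgroup (polyseq (i + j)) ?F"
        using subgroup_polyseq_step[of "i + j" "i + j"] step less.prems by auto
      moreover have "F.comm h g \<in> polyseq (i + j)"
        using ji g h unfolding comm_ok_def by (simp add: add.commute)
      ultimately show "F.comm g h \<in> polyseq (i + j)"
        using F.inv_comm[OF gh(2,1)] subgroup.m_inv_closed by fastforce
    qed
  qed
qed

lemma subgroup_polyseq: "1 \<le> m \<Longrightarrow> subgroup (polyseq m) (fun_group G)"
  using subgroup_polyseq_step[of 0 m] comm_ok by simp

lemma polyseq_conj:
  assumes "1 \<le> i" "1 \<le> m" "g \<in> polyseq i" "y \<in> polyseq m"
  shows "g \<otimes>\<^bsub>fun_group G\<^esub> y \<otimes>\<^bsub>fun_group G\<^esub> inv\<^bsub>fun_group G\<^esub> g \<in> polyseq m"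
    and "inv\<^bsub>fun_group G\<^esub> g \<otimes>\<^bsub>fun_group G\<^esub> y \<otimes>\<^bsub>fun_group G\<^esub> g \<in> polyseq m"
  using assms by (auto intro!: conj_polyseq1[where i = i] conj_polyseq2[where i = i] subgroup_polyseq comm_ok)

end

section \<open>The chain of sequence groups on which the induction runs\<close>

locale seq_chain = group G for G (structure) +
  fixes N :: "nat \<Rightarrow> (int \<Rightarrow> 'a) set" and M :: nat
  assumes N_closed: "f \<in> N i \<Longrightarrow> f n \<in> carrier G"
    and N_zero: "f \<in> N i \<Longrightarrow> f 0 = \<one>"
    and N_one: "(\<lambda>_. \<one>) \<in> N i"
    and N_mult: "f \<in> N i \<Longrightarrow> g \<in> N i \<Longrightarrow> (\<lambda>n. f n \<otimes> g n) \<in> N i"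
    and N_inv: "f \<in> N i \<Longrightarrow> (\<lambda>n. inv (f n)) \<in> N i"
    and N_Suc: "N (Suc i) \<subseteq> N i"
    and N_conj: "g \<in> N 0 \<Longrightarrow> f \<in> N i \<Longrightarrow> (\<lambda>n. g n \<otimes> f n \<otimes> inv (g n)) \<in> N i"
    and N_shift: "f \<in> N i \<Longrightarrow> (\<lambda>m. inv (f m) \<otimes> (inv (f n) \<otimes> f (m + n))) \<in> N (Suc i)"
    and N_trivial: "N M = {\<lambda>_. \<one>}"

context filtered_group
begin

interpretation F: group "fun_group G"
  by (rule group_fun_group)

text \<open>The chain starts at \<open>polyseq 1\<close> because levels are known to be groups only
  from index 1 on.\<close>

lemma seq_chain_polyseq: "seq_chain G (\<lambda>i. {f \<in> polyseq (Suc i). f 0 = \<one>}) M"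
proof
  let ?F = "fun_group G"
  fix i :: nat and f g :: "int \<Rightarrow> 'a"
  interpret S: subgroup "polyseq (Suc i)" ?F by (rule subgroup_polyseq) simp
  have fc: "f n \<in> carrier G" "f \<in> carrier ?F" if "f \<in> polyseq j" for f n j 
    using polyseq_closed[OF that] by (auto simp: carrier_fun_group)
  show "(\<lambda>n. f n \<otimes> g n) \<in> {f \<in> polyseq (Suc i). f 0 = \<one>}"
    if "f \<in> {f \<in> polyseq (Suc i). f 0 = \<one>}" "g \<in> {f \<in> polyseq (Suc i). f 0 = \<one>}" 
    using S.m_closed[of f g] that by (simp add: fun_group_def)
  show "(\<lambda>n. inv (f n)) \<in> {f \<in> polyseq (Suc i). f 0 = \<one>}" if "f \<in> {f \<in> polyseq (Suc i). f 0 = \<one>}"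
    using that S.m_inv_closed[of f] inv_fun_group[of f] fc by simp
  show "(\<lambda>n. g n \<otimes> f n \<otimes> inv (g n)) \<in> {f \<in> polyseq (Suc i). f 0 = \<one>}"
    if "g \<in> {f \<in> polyseq (Suc 0). f 0 = \<one>}" "f \<in> {f \<in> polyseq (Suc i). f 0 = \<one>}"
  proof -
    have "g \<otimes>\<^bsub>?F\<^esub> f \<otimes>\<^bsub>?F\<^esub> inv\<^bsub>?F\<^esub> g = (\<lambda>n. g n \<otimes> f n \<otimes> inv (g n))"
      using that fc by (auto simp: fun_eq_iff)
    then show ?thesis using that polyseq_conj(1)[of "Suc 0" "Suc i" g f] fc by simp
  qed
  show "(\<lambda>m. inv (f m) \<otimes> (inv (f n) \<otimes> f (m + n))) \<in> {f \<in> polyseq (Suc (Suc i)). f 0 = \<one>}" 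
    if "f \<in> {f \<in> polyseq (Suc i). f 0 = \<one>}" for n
  proof -
    have f: "f \<in> polyseq (Suc i)" "f 0 = \<one>" using that by auto
    interpret S': subgroup "polyseq (Suc (Suc i))" ?F by (rule subgroup_polyseq) simp
    define a where "a = diff (True, n) f"
    have a: "a \<in> polyseq (Suc (Suc i))" unfolding a_def by (rule diff_polyseq[OF f(1)])
    \<comment> \<open>The normalisation \<open>f 0 = \<one>\<close> makes the value
      \<open>f n\<close> itself a difference, so the constant \<open>f n\<close> lies one level
      deeper than \<open>f\<close>.\<close>
    have "a 0 = f n" using f fc[OF f(1)] by (simp add: a_def)
    then have c: "inv\<^bsub>?F\<^esub> (\<lambda>_. f n) \<in> polyseq (Suc (Suc i))"
      using polyseq_value[OF a, of 0] by (intro S'.m_inv_closed const_polyseq) simp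
    have "inv\<^bsub>?F\<^esub> f \<otimes>\<^bsub>?F\<^esub> (inv\<^bsub>?F\<^esub> (\<lambda>_. f n) \<otimes>\<^bsub>?F\<^esub> a) \<otimes>\<^bsub>?F\<^esub> f \<in> polyseq (Suc (Suc i))"
      by (rule polyseq_conj(2)[OF _ _ f(1)]) (use S'.m_closed[OF c a] in auto)
    also have "inv\<^bsub>?F\<^esub> f \<otimes>\<^bsub>?F\<^esub> (inv\<^bsub>?F\<^esub> (\<lambda>_. f n) \<otimes>\<^bsub>?F\<^esub> a) \<otimes>\<^bsub>?F\<^esub> f
      = (\<lambda>m. inv (f m) \<otimes> (inv (f n) \<otimes> f (m + n)))"
    proof
      fix m
      have "(\<lambda>_. f n) \<in> carrier ?F" using fc[OF f(1)] by (simp add: carrier_fun_group)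
      then show "(inv\<^bsub>?F\<^esub> f \<otimes>\<^bsub>?F\<^esub> (inv\<^bsub>?F\<^esub> (\<lambda>_. f n) \<otimes>\<^bsub>?F\<^esub> a) \<otimes>\<^bsub>?F\<^esub> f) m
        = inv (f m) \<otimes> (inv (f n) \<otimes> f (m + n))"
        using fc[OF f(1)] by (simp add: a_def m_assoc)
    qed
    finally show ?thesis using f fc[OF f(1)] by simp
  qed
  show "{f \<in> polyseq (Suc M). f 0 = \<one>} = {\<lambda>_. \<one>}"
    using polyseq_trivial[of "Suc M"] by auto
  show "{f \<in> polyseq (Suc (Suc i)). f 0 = \<one>} \<subseteq> {f \<in> polyseq (Suc i). f 0 = \<one>}"
    using polyseq_Suc[of "Suc i"] by blast
qed (use polyseq_closed one_polyseq in \<open>auto simp: carrier_fun_group\<close>)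

text \<open>Differences of a periodic sequence are periodic and, by descending induction, constant.
  So \<open>f\<close> picks up a fixed factor \<open>c\<close> under each translation by
  \<open>m\<close>; after \<open>\<bar>t\<bar>\<close> such translations it has returned, so
  \<open>c\<close> has finite order and is trivial.\<close>

lemma periodic_polyseq_const:
  assumes tf: "\<And>c n. c \<in> carrier G \<Longrightarrow> n \<noteq> 0 \<Longrightarrow> c [^] (n::int) = \<one> \<Longrightarrow> c = \<one>"
    and "f \<in> polyseq i" "\<And>m. f (m + t) = f m" "t \<noteq> 0"
  shows "f m = f 0"
  using assms(2-)
proof (induction "M - i" arbitrary: i f m rule: less_induct)
  case less
  show ?case
  proof (cases "M \<le> i")
    case True
    then show ?thesis using less.prems polyseq_trivial[of i] by simp
  next
    case False
    have fc: "f m \<in> carrier G" for m using polyseq_closed[OF less.prems(1)] by (simp add: carrier_fun_group)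
    define c where "c = diff (True, m) f 0"
    have c: "c \<in> carrier G" unfolding c_def using fc by simp
    have *: "diff (True, m) f x = c" for x
      unfolding c_def
    proof (rule less.hyps[OF _ diff_polyseq[OF less.prems(1)]])
      show "diff (True, m) f (x + t) = diff (True, m) f x" for x
        using less.prems(2)[of x] less.prems(2)[of "x + m"] by (simp add: algebra_simps)
    qed (use False less.prems in auto)
    have step: "f (x + m) = c \<otimes> f x" for x
      using *[of x] fc[of x] fc[of "x + m"] c inv_solve_right[of c "f (x+m)" "f x"] by (simp add: eq_commute)
    have pw: "f (int k * m) = c [^] k \<otimes> f 0" for k
    proof (induction k)
      case (Suc k)
      have "f (int (Suc k) * m) = c \<otimes> f (int k * m)"
        using step[of "int k * m"] by (simp add: algebra_simps)
      then show ?case using Suc c fc by (simp add: m_assoc[symmetric] nat_pow_Suc2[symmetric] del: nat_pow_Suc of_nat_Suc)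
    qed (use fc in simp)
    have per: "f (x + int k * t) = f x" for k x
    proof (induction k)
      case (Suc k)
      then show ?case using less.prems(2)[of "x + int k * t"] by (simp add: algebra_simps)
    qed simp
    define k where "k = nat \<bar>t\<bar>"
    have k: "k \<noteq> 0" using less.prems(3) by (simp add: k_def)
    have "f (int k * m) = f 0"
    proof -
      \<comment> \<open>Writes \<open>\<bar>t\<bar> * m\<close> as a multiple of \<open>t\<close>.
        The factor may be negative, whereas \<open>per\<close> covers natural multiples
        only.\<close>
      define u where "u = m * sgn t"
      have u: "int k * m = u * t"
      proof -
        have "int k = \<bar>t\<bar>" by (simp add: k_def)
        also have "\<dots> = t * sgn t" by (rule abs_sgn)
        finally show ?thesis by (simp add: u_def)
      qed
      show ?thesis
      proof (cases "u \<ge> 0")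
        case True
        then show ?thesis using per[of 0 "nat u"] u by simp
      next
        case False
        then have "u * t + int (nat (- u)) * t = 0" by simp
        then show ?thesis using per[of "u * t" "nat (- u)"] u by simp
      qed
    qed
    then have "c [^] k \<otimes> f 0 = f 0" using pw[of k] by simp
    then have "c [^] k = \<one>" using fc[of 0] c by (metis nat_pow_closed r_cancel_one)
    then have "c = \<one>" using tf[OF c, of "int k"] k by (simp add: int_pow_int)
    then show ?thesis using step[of 0] fc by simp
  qed
qed

end

section \<open>The filtration of a nilpotent group\<close>

context group
begin

lemma lower_central_series_normal: "lower_central_series G n \<lhd> G"
proof (induction n)
  case 0
  show ?case by (simp add: normal_inv_iff subgroup_self)
next
  case (Suc n)
  interpret L: normal "lower_central_series G n" G by (rule Suc)
  let ?K = "\<Union>a \<in> lower_central_series G n. \<Union>b \<in> carrier G. {a \<otimes> b \<otimes> inv a \<otimes> inv b}"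
  show ?case
    unfolding lower_central_series.simps
  proof (rule normal_generateI)
    show "?K \<subseteq> carrier G" using L.mem_carrier by auto
    fix h g assume "h \<in> ?K" and g: "g \<in> carrier G"
    then obtain a b where ab: "a \<in> lower_central_series G n" "b \<in> carrier G" "h = a \<otimes> b \<otimes> inv a \<otimes> inv b"
      by blast
    have a: "a \<in> carrier G" using ab by simp
    have "g \<otimes> h \<otimes> inv g = (g \<otimes> a \<otimes> inv g) \<otimes> (g \<otimes> b \<otimes> inv g) \<otimes> inv (g \<otimes> a \<otimes> inv g) \<otimes> inv (g \<otimes> b \<otimes> inv g)"
      using a ab g by (simp add: m_assoc inv_mult_group)
    moreover have "g \<otimes> a \<otimes> inv g \<in> lower_central_series G n"
      using L.inv_op_closed2[OF g ab(1)] .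
    moreover have "g \<otimes> b \<otimes> inv g \<in> carrier G" using g ab by simp
    ultimately show "g \<otimes> h \<otimes> inv g \<in> ?K" by blast
  qed
qed

lemma lower_central_series_subgroup: "subgroup (lower_central_series G n) G"
  using lower_central_series_normal normal_imp_subgroup by blast

lemma comm_lower_central_series:
  assumes "a \<in> lower_central_series G n" "b \<in> carrier G"
  shows "comm a b \<in> lower_central_series G (Suc n)"
  using assms by (auto simp: comm_def intro!: generate.incl)

lemma lower_central_series_Suc: "lower_central_series G (Suc n) \<subseteq> lower_central_series G n"
proof -
  interpret L: normal "lower_central_series G n" G by (rule lower_central_series_normal)
  have "a \<otimes> b \<otimes> inv a \<otimes> inv b \<in> lower_central_series G n"
    if "a \<in> lower_central_series G n" "b \<in> carrier G" for a b
  proof -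
    have "a \<otimes> (b \<otimes> inv a \<otimes> inv b) \<in> lower_central_series G n"
      using L.inv_op_closed2[OF that(2), of "inv a"] that by auto
    then show ?thesis using that L.mem_carrier[OF that(1)] by (simp add: m_assoc)
  qed
  then show ?thesis
    unfolding lower_central_series.simps
    by (intro generate_subgroup_incl lower_central_series_subgroup) auto
qed

lemma lower_central_series_antimono: "m \<le> n \<Longrightarrow> lower_central_series G n \<subseteq> lower_central_series G m"
proof (induction n rule: dec_induct)
  case (step n)
  then show ?case using lower_central_series_Suc[of n] by blast
qed simp

text \<open>A commutator with any group element deepens the deeper of the two entries by one. This
  replaces the sharper additive bound, which would need the three subgroups lemma.\<close>

lemma comm_lower_central_series_max:
  assumes "a \<in> lower_central_series G m" "b \<in> lower_central_series G n"
  shows "comm a b \<in> lower_central_series G (Suc (max m n))"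
proof -
  have ab: "a \<in> carrier G" "b \<in> carrier G"
    using assms lower_central_series_subgroup subgroup.mem_carrier by metis+
  show ?thesis
  proof (cases "m \<le> n")
    case True
    interpret L: subgroup "lower_central_series G (Suc n)" G by (rule lower_central_series_subgroup)
    have "inv (comm b a) \<in> lower_central_series G (Suc n)"
      by (rule L.m_inv_closed[OF comm_lower_central_series[OF assms(2) ab(1)]])
    then show ?thesis using True ab inv_comm[of b a] by (simp add: max_absorb2 del: lower_central_series.simps)
  next
    case False
    then show ?thesis using comm_lower_central_series[OF assms(1) ab(2)] by (simp add: max_absorb1 del: lower_central_series.simps)
  qed
qed

lemma lower_central_series_trivial:
  assumes "lower_central_series G s = {\<one>}" "s \<le> n"
  shows "lower_central_series G n = {\<one>}"
  using lower_central_series_antimono[OF assms(2)] assms(1) 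
    subgroup.one_closed[OF lower_central_series_subgroup[of n]] by blast

text \<open>Crude bounds on commutators of the lower central series suffice because the filtration is
  stretched exponentially.\<close>

lemma filtered_group_lower_central_series:
  assumes s: "lower_central_series G s = {\<one>}" and K: "1 \<le> K"
  shows "filtered_group G (\<lambda>i. lower_central_series G (LEAST a. i \<le> K * 2 ^ a)) (Suc (K * 2 ^ s))"
proof -
  define l where "l i = (LEAST a. i \<le> K * 2 ^ a)" for i
  have ex: "\<exists>a. i \<le> K * 2 ^ a" for i :: nat
  proof -
    have "i \<le> 2 ^ i" using less_exp[of i] by simp
    also have "\<dots> \<le> K * 2 ^ i" using K by simp
    finally show ?thesis ..
  qed
  have le: "i \<le> K * 2 ^ l i" for i unfolding l_def by (rule LeastI_ex) (rule ex)
  have l_le: "l i \<le> a" if "i \<le> K * 2 ^ a" for i a unfolding l_def by (rule Least_le) (rule that)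
  have le_max: "i \<le> K * 2 ^ max (l i) (l j)" "j \<le> K * 2 ^ max (l i) (l j)" for i j
    using le[of i] le[of j] by (auto elim!: order_trans intro!: mult_left_mono power_increasing)
  show ?thesis
    unfolding l_def[symmetric]
  proof (intro filtered_group.intro filtered_group_axioms.intro is_group lower_central_series_subgroup)
    show "lower_central_series G (l (Suc i)) \<subseteq> lower_central_series G (l i)" for i
      using le[of "Suc i"] by (intro lower_central_series_antimono l_le) simp
    show "comm a b \<in> lower_central_series G (l (i + j))"
      if "a \<in> lower_central_series G (l i)" "b \<in> lower_central_series G (l j)" for a b i j
    proof -
      \<comment> \<open>Both indices are at most \<open>K * 2 ^ max (l i) (l j)\<close>, so their
        sum costs one more doubling, matching the single step gained by the commutator.\<close>
      have "l (i + j) \<le> Suc (max (l i) (l j))"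
        using le_max(1)[of i j] le_max(2)[of j i] by (intro l_le) simp
      then show ?thesis
        using comm_lower_central_series_max[OF that] lower_central_series_antimono by blast
    qed
    show "lower_central_series G (l i) = {\<one>}" if "Suc (K * 2 ^ s) \<le> i" for i
    proof (rule lower_central_series_trivial[OF s])
      show "s \<le> l i"
      proof (rule ccontr)
        assume "\<not> s \<le> l i"
        then have "K * 2 ^ l i \<le> K * 2 ^ s" by simp
        then show False using le[of i] that by linarith
      qed
    qed
  qed
qed

text \<open>The last nontrivial term of the lower central series is central.\<close>

lemma nilpotent_center:
  assumes "nilpotent_group G" "carrier G \<noteq> {\<one>}"
  obtains z where "z \<in> carrier G" "z \<noteq> \<one>" "\<And>g. g \<in> carrier G \<Longrightarrow> z \<otimes> g = g \<otimes> z"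
proof -
  obtain n where n: "lower_central_series G n = {\<one>}" using assms by (auto simp: nilpotent_group_def)
  define s where "s = (LEAST n. lower_central_series G n = {\<one>})"
  have s: "lower_central_series G s = {\<one>}" unfolding s_def by (rule LeastI) (rule n)
  have "s \<noteq> 0" using s assms by (metis lower_central_series.simps(1))
  then obtain r where r: "s = Suc r" using not0_implies_Suc by blast
  have "lower_central_series G r \<noteq> {\<one>}" 
    using not_less_Least[of r "\<lambda>n. lower_central_series G n = {\<one>}"] r unfolding s_def by simp
  moreover have "\<one> \<in> lower_central_series G r"
    by (rule subgroup.one_closed[OF lower_central_series_subgroup])
  ultimately obtain z where z: "z \<in> lower_central_series G r" "z \<noteq> \<one>" by blast
  have zc: "z \<in> carrier G" by (rule subgroup.mem_carrier[OF lower_central_series_subgroup z(1)])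
  have "z \<otimes> g = g \<otimes> z" if "g \<in> carrier G" for g
    using comm_lower_central_series[OF z(1) that] s comm_eq_one_iff[OF zc that]
    unfolding r by (simp del: lower_central_series.simps)
  then show ?thesis using that zc z(2) by blast
qed

end

section \<open>Powers with polynomial exponents as polynomial sequences\<close>

fun int_diff :: "bool \<times> int \<Rightarrow> (int \<Rightarrow> int) \<Rightarrow> int \<Rightarrow> int" where
  "int_diff (l, t) q n = q (n + t) - q n"

text \<open>The leading coefficients cancel. Zero is listed separately because its degree is 0,
  which is not below the degree of a constant.\<close>

lemma degree_pcompose_shift_diff:
  fixes p :: "rat poly"
  assumes "p \<noteq> 0"
  shows "p \<circ>\<^sub>p [:t, 1:] - p = 0 \<or> degree (p \<circ>\<^sub>p [:t, 1:] - p) < degree p"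
proof -
  define r where "r = p \<circ>\<^sub>p [:t, 1:] - p"
  have deg: "degree (p \<circ>\<^sub>p [:t, 1:]) = degree p" by (simp add: degree_pcompose)
  have "coeff r (degree p) = 0"
    using lead_coeff_comp[of "[:t, 1:]" p] unfolding r_def deg by simp
  moreover have "degree r \<le> degree p"
    unfolding r_def using deg by (intro degree_diff_le) auto
  ultimately show ?thesis
    unfolding r_def[symmetric] by (metis le_neq_implies_less leading_coeff_0_iff)
qed

lemma fold_int_diff_eq_0:
  fixes p :: "rat poly"
  assumes "\<And>n. of_int (q n) = poly p (of_int n)" "p = 0 \<or> degree p < length ts"
  shows "fold int_diff ts q = (\<lambda>_. 0)"
  using assms
proof (induction ts arbitrary: p q)
  case Nil
  then have "q n = 0" for n by (metis degree_0 list.size(3) not_less_zero of_int_eq_0_iff poly_0)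
  then show ?case by auto
next
  case (Cons s ts)
  obtain l t where s: "s = (l, t)" by force
  let ?p = "p \<circ>\<^sub>p [:of_int t, 1:] - p"
  have "fold int_diff ts (int_diff s q) = (\<lambda>_. 0)"
  proof (rule Cons.IH[of _ ?p])
    show "of_int (int_diff s q n) = poly ?p (of_int n)" for n
      using Cons.prems(1)[of "n + t"] Cons.prems(1)[of n] by (simp add: s poly_pcompose add.commute)
    show "?p = 0 \<or> degree ?p < length ts"
    proof (cases "p = 0")
      case False
      then show ?thesis using degree_pcompose_shift_diff[of p "of_int t"] Cons.prems(2) by auto
    qed simp
  qed
  then show ?case by simp
qed

context filtered_group
begin

text \<open>Powers of one element commute, so left and right differences both become differences of
  exponents. \<open>int_diff\<close> takes the same pairs as \<open>diff\<close> so that one list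
  drives both folds.\<close>

lemma fold_diff_pow:
  assumes S: "S \<in> carrier G"
  shows "fold diff ts (\<lambda>n. S [^] (q n :: int)) = (\<lambda>n. S [^] (fold int_diff ts q n))"
proof (induction ts arbitrary: q)
  case (Cons s ts)
  obtain l t where s: "s = (l, t)" by force
  have "diff s (\<lambda>n. S [^] (q n :: int)) = (\<lambda>n. S [^] (int_diff s q n))"
  proof
    show "diff s (\<lambda>n. S [^] q n) n = S [^] int_diff s q n" for n
    proof -
      have "S [^] (q (n + t) - q n) = S [^] (- q n) \<otimes> S [^] q (n + t)"
        using int_pow_mult[OF S, of "- q n" "q (n + t)"] by (simp add: algebra_simps)
      moreover have "S [^] (q (n + t) - q n) = S [^] q (n + t) \<otimes> S [^] (- q n)"
        using int_pow_mult[OF S, of "q (n + t)" "- q n"] by (simp add: algebra_simps)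
      ultimately show ?thesis using S by (simp add: s int_pow_neg)
    qed
  qed
  then show ?case using Cons.IH[of "int_diff s q"] by simp
qed simp

text \<open>Up to \<open>degree p\<close> differences are unconstrained, as the filtration is still
  the whole group there; any further difference makes the exponent vanish.\<close>

lemma pow_polyseq:
  assumes S: "S \<in> carrier G" and H: "\<And>i. i \<le> Suc (degree p) \<Longrightarrow> H i = carrier G"
    and q: "\<And>n. of_int (q n) = poly (p :: rat poly) (of_int n)"
  shows "(\<lambda>n. S [^] (q n :: int)) \<in> polyseq 1"
proof -
  have "S [^] (fold int_diff ts q n) \<in> H (1 + length ts)" for ts n
  proof (cases "length ts \<le> degree p")
    case True
    then show ?thesis using H[of "1 + length ts"] S by simp
  next
    case False
    then have "fold int_diff ts q = (\<lambda>_. 0)" by (intro fold_int_diff_eq_0[OF q]) simp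
    then show ?thesis using subgroup.one_closed[OF H_subgroup] by simp
  qed
  then show ?thesis by (simp add: polyseq_def fold_diff_pow[OF S])
qed

end

section \<open>Simultaneous returns for powers\<close>

text \<open>\<open>cover\<close> is minimality with compactness: the waiting time \<open>l\<close>
  is uniform in the point. \<open>mixing\<close> is weak mixing, phrased through two pairs of open
  sets that share a time.\<close>

locale mixing_system = group G + group_action G E \<phi>
  for G (structure) and E :: "'x set" and \<phi> +
  fixes X :: "'x topology"
  assumes topspace_X: "topspace X = E"
    and nonempty: "E \<noteq> {}"
    and continuous: "g \<in> carrier G \<Longrightarrow> continuous_map X X (\<phi> g)"
    and cover: "S \<in> carrier G \<Longrightarrow> S \<noteq> \<one> \<Longrightarrow> openin X U \<Longrightarrow> U \<noteq> {} \<Longrightarrow>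
      \<exists>l\<ge>0. \<forall>x\<in>E. \<exists>j\<in>{0..l}. \<phi> (S [^] (j::int)) x \<in> U"
    and mixing: "S \<in> carrier G \<Longrightarrow> S \<noteq> \<one> \<Longrightarrow> openin X U1 \<Longrightarrow> U1 \<noteq> {} \<Longrightarrow>
      openin X U2 \<Longrightarrow> U2 \<noteq> {} \<Longrightarrow> openin X V1 \<Longrightarrow> V1 \<noteq> {} \<Longrightarrow> openin X V2 \<Longrightarrow> V2 \<noteq> {} \<Longrightarrow>
      \<exists>n::int. (\<exists>x\<in>U1. \<phi> (S [^] n) x \<in> V1) \<and> (\<exists>x\<in>U2. \<phi> (S [^] n) x \<in> V2)"
begin

definition ne_open :: "'x set \<Rightarrow> bool" where
  "ne_open U \<longleftrightarrow> openin X U \<and> U \<noteq> {}"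

definition pre :: "'a \<Rightarrow> 'x set \<Rightarrow> 'x set" where
  "pre g U = {x \<in> E. \<phi> g x \<in> U}"

definition meets :: "'a \<Rightarrow> 'x set \<Rightarrow> 'x set \<Rightarrow> bool" where
  "meets g V U \<longleftrightarrow> (\<exists>x\<in>V. \<phi> g x \<in> U)"

lemma ne_open_subset: "ne_open U \<Longrightarrow> x \<in> U \<Longrightarrow> x \<in> E"
  unfolding ne_open_def using openin_subset topspace_X by blast

lemma ne_open_E: "ne_open E"
  unfolding ne_open_def using topspace_X nonempty openin_topspace by metis

lemma act_closed: "g \<in> carrier G \<Longrightarrow> x \<in> E \<Longrightarrow> \<phi> g x \<in> E"
  by (rule element_image) auto

lemma act_mult: "g \<in> carrier G \<Longrightarrow> h \<in> carrier G \<Longrightarrow> x \<in> E \<Longrightarrow> \<phi> (g \<otimes> h) x = \<phi> g (\<phi> h x)"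
  by (rule composition_rule)

lemma act_one: "x \<in> E \<Longrightarrow> \<phi> \<one> x = x"
  by (metis id_eq_one restrict_apply')

lemma openin_pre: "g \<in> carrier G \<Longrightarrow> openin X U \<Longrightarrow> openin X (pre g U)"
  unfolding pre_def using openin_continuous_map_preimage[OF continuous] topspace_X by metis

lemma ne_open_pre:
  assumes "g \<in> carrier G" "ne_open U"
  shows "ne_open (pre g U)"
proof -
  obtain u where u: "u \<in> U" "u \<in> E" using assms(2) ne_open_subset unfolding ne_open_def by blast
  have "\<phi> g (\<phi> (inv g) u) = u" using act_mult[of g "inv g" u] u assms act_one by simp
  then have "\<phi> (inv g) u \<in> pre g U" using u assms act_closed by (simp add: pre_def)
  then show ?thesis using openin_pre[OF assms(1)] assms(2) unfolding ne_open_def by blast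
qed

lemma ne_open_Int_pre:
  assumes "g \<in> carrier G" "ne_open V" "ne_open U" "meets g V U"
  shows "ne_open (V \<inter> pre g U)"
proof -
  have "V \<inter> pre g U \<noteq> {}"
    using assms(4) ne_open_subset[OF assms(2)] by (auto simp: meets_def pre_def)
  then show ?thesis using assms openin_pre unfolding ne_open_def by blast
qed

lemma meets_pre:
  assumes "g \<in> carrier G" "h \<in> carrier G" "ne_open V" 
  shows "meets g V (pre h U) \<longleftrightarrow> meets (h \<otimes> g) V U"
  using ne_open_subset[OF assms(3)] act_mult[OF assms(2,1)] act_closed[OF assms(1)]
  by (auto simp: meets_def pre_def)

text \<open>Furstenberg's argument that return time sets of a weakly mixing map form a filter base:
  a common time \<open>n\<close> carries \<open>V\<close> to \<open>A\<close> and \<open>U\<close>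
  to \<open>B\<close>, and since powers of \<open>c\<close> commute, the sets cut out by
  \<open>n\<close> force both returns.\<close>

lemma meets_filter_base:
  assumes c: "c \<in> carrier G" "c \<noteq> \<one>" and "finite R" "\<forall>(V, U)\<in>R. ne_open V \<and> ne_open U"
  shows "\<exists>A B. ne_open A \<and> ne_open B \<and> (\<forall>m::int. meets (c [^] m) A B \<longrightarrow> (\<forall>(V, U)\<in>R. meets (c [^] m) V U))"
  using assms(3,4)
proof (induction R rule: finite_induct)
  case empty
  then show ?case using ne_open_E by blast
next
  case (insert q R)
  obtain V U where q: "q = (V, U)" by force
  have VU: "ne_open V" "ne_open U" using insert.prems q by auto
  obtain A B where AB: "ne_open A" "ne_open B"
    "\<And>m::int. meets (c [^] m) A B \<Longrightarrow> \<forall>(V, U)\<in>R. meets (c [^] m) V U" using insert by auto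
  obtain n :: int where n: "meets (c [^] n) V A" "meets (c [^] n) U B"
    using mixing[OF c, of V U A B] VU AB(1,2) unfolding ne_open_def meets_def by blast
  let ?A = "V \<inter> pre (c [^] n) A" and ?B = "U \<inter> pre (c [^] n) B"
  have "ne_open ?A" "ne_open ?B" using n c VU AB(1,2) by (auto intro!: ne_open_Int_pre)
  moreover have "\<forall>(V, U)\<in>insert q R. meets (c [^] m) V U" if m: "meets (c [^] m) ?A ?B" for m :: int
  proof -
    obtain x where x: "x \<in> V" "x \<in> E" "\<phi> (c [^] n) x \<in> A" "\<phi> (c [^] m) x \<in> U"
      "\<phi> (c [^] n) (\<phi> (c [^] m) x) \<in> B"
      using m by (auto simp: meets_def pre_def)
    have "\<phi> (c [^] n) (\<phi> (c [^] m) x) = \<phi> (c [^] m) (\<phi> (c [^] n) x)"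
      using x(2) c act_mult[of "c [^] n" "c [^] m" x] act_mult[of "c [^] m" "c [^] n" x]
        int_pow_mult[of c n m] int_pow_mult[of c m n] by (simp add: add.commute)
    then have "meets (c [^] m) A B" using x unfolding meets_def by auto
    then show ?thesis using AB(3)[of m] x q unfolding meets_def by auto
  qed
  ultimately show ?case by blast
qed

text \<open>A return to the preimage of \<open>U\<close> under \<open>c [^] i\<close> at time
  \<open>m\<close> is a return to \<open>U\<close> at time \<open>m + i\<close>; requesting all
  these preimages at once yields a run.\<close>

lemma meets_run_of_meets:
  assumes "\<And>R. finite R \<Longrightarrow> \<forall>(c, V, U)\<in>R. c \<in> C \<and> ne_open V \<and> ne_open U \<Longrightarrow>
      \<exists>m::int. \<forall>(c, V, U)\<in>R. meets (c [^] m) V U"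
    and C: "C \<subseteq> carrier G" and R: "finite R" "\<forall>(c, V, U)\<in>R. c \<in> C \<and> ne_open V \<and> ne_open U"
  shows "\<exists>m::int. \<forall>i\<in>{0..l}. \<forall>(c, V, U)\<in>R. meets (c [^] (m + i)) V U"
proof -
  let ?R = "(\<lambda>((c, V, U), i::int). (c, V, pre (c [^] i) U)) ` (R \<times> {0..l})"
  have "\<exists>m::int. \<forall>(c, V, U)\<in>?R. meets (c [^] m) V U"
    using R C by (intro assms(1)) (auto intro!: ne_open_pre)
  then obtain m :: int where m: "\<forall>(c, V, U)\<in>?R. meets (c [^] m) V U" ..
  have "meets (c [^] (m + i)) V U" if "i \<in> {0..l}" "(c, V, U) \<in> R" for i c V U
  proof -
    have "(c, V, pre (c [^] i) U) \<in> ?R" using that by (intro image_eqI[of _ _ "((c, V, U), i)"]) auto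
    then have "meets (c [^] m) V (pre (c [^] i) U)" using m by blast
    moreover have "c \<in> carrier G" "ne_open V" using that R C by auto
    ultimately show ?thesis using meets_pre[of "c [^] m" "c [^] i" V U] int_pow_mult[of c i m]
      by (simp add: add.commute)
  qed
  then show ?thesis by blast
qed

text \<open>A syndetic set of return times for one element meets a thick set for the others.\<close>

lemma meets_simultaneously:
  assumes "finite C" "C \<subseteq> carrier G - {\<one>}" "finite R" "\<forall>(c, V, U)\<in>R. c \<in> C \<and> ne_open V \<and> ne_open U"
  shows "\<exists>m::int. \<forall>(c, V, U)\<in>R. meets (c [^] m) V U"
  using assms
proof (induction C arbitrary: R rule: finite_induct)
  case empty
  then show ?case by fastforce
next
  case (insert c C)
  have c: "c \<in> carrier G" "c \<noteq> \<one>" and C: "C \<subseteq> carrier G - {\<one>}" using insert.prems by auto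
  let ?Rc = "snd ` {q \<in> R. fst q = c}" and ?R = "{q \<in> R. fst q \<noteq> c}"
  have "finite ?Rc" "\<forall>(V, U)\<in>?Rc. ne_open V \<and> ne_open U" using insert.prems by auto
  then obtain A B where AB: "ne_open A" "ne_open B"
    "\<And>m::int. meets (c [^] m) A B \<Longrightarrow> \<forall>(V, U)\<in>?Rc. meets (c [^] m) V U"
    using meets_filter_base[OF c, of ?Rc] by blast
  obtain l where l: "\<forall>x\<in>E. \<exists>j\<in>{0..l}. \<phi> (c [^] (j::int)) x \<in> B"
    using cover[OF c] AB(2) unfolding ne_open_def by blast
  have "\<exists>m::int. \<forall>i\<in>{0..l}. \<forall>(c, V, U)\<in>?R. meets (c [^] (m + i)) V U"
    by (rule meets_run_of_meets[OF insert.IH[OF C]]) (use C insert.prems in auto)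
  then obtain m :: int where m: "\<And>i. i \<in> {0..l} \<Longrightarrow> \<forall>(c, V, U)\<in>?R. meets (c [^] (m + i)) V U" by blast
  obtain x where x: "x \<in> A" "x \<in> E" using AB(1) ne_open_subset[OF AB(1)] unfolding ne_open_def by blast
  obtain j where j: "j \<in> {0..l}" "\<phi> (c [^] j) (\<phi> (c [^] m) x) \<in> B"
    using l act_closed[of "c [^] m" x] x c by force
  have "\<phi> (c [^] (m + j)) x \<in> B"
    using j act_mult[of "c [^] j" "c [^] m" x] x c int_pow_mult[of c j m] by (simp add: add.commute)
  then have "meets (c [^] (m + j)) A B" using x unfolding meets_def by blast
  from AB(3)[OF this] m[OF j(1)] have "\<forall>(c, V, U)\<in>R. meets (c [^] (m + j)) V U"
    by force
  then show ?case ..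
qed

lemma meets_simultaneously_run:
  assumes "finite C" "C \<subseteq> carrier G - {\<one>}" "finite R" "\<forall>(c, V, U)\<in>R. c \<in> C \<and> ne_open V \<and> ne_open U"
  shows "\<exists>m::int. \<forall>i\<in>{0..l}. \<forall>(c, V, U)\<in>R. meets (c [^] (m + i)) V U"
  by (rule meets_run_of_meets[OF meets_simultaneously[OF assms(1,2)]]) (use assms in auto)

end

section \<open>Weights of systems of sequences\<close>

context seq_chain
begin

definition quo :: "(int \<Rightarrow> 'a) \<Rightarrow> (int \<Rightarrow> 'a) \<Rightarrow> int \<Rightarrow> 'a" where
  "quo f g = (\<lambda>n. f n \<otimes> inv (g n))"

definition lquo :: "(int \<Rightarrow> 'a) \<Rightarrow> (int \<Rightarrow> 'a) \<Rightarrow> int \<Rightarrow> 'a" where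
  "lquo f g = (\<lambda>n. inv (f n) \<otimes> g n)"

definition shift :: "int \<Rightarrow> (int \<Rightarrow> 'a) \<Rightarrow> int \<Rightarrow> 'a" where
  "shift n f = (\<lambda>m. inv (f n) \<otimes> f (m + n))"

text \<open>The left coset of \<open>f\<close> modulo \<open>N (Suc i)\<close> when
  \<open>f \<in> N i\<close>; it stands for the leading coefficient of \<open>f\<close>.\<close>

definition coset :: "nat \<Rightarrow> (int \<Rightarrow> 'a) \<Rightarrow> (int \<Rightarrow> 'a) set" where
  "coset i f = {g \<in> N i. lquo f g \<in> N (Suc i)}"

definition cosets :: "(int \<Rightarrow> 'a) set \<Rightarrow> nat \<Rightarrow> (int \<Rightarrow> 'a) set set" where
  "cosets A i = coset i ` {f \<in> A. f \<in> N i \<and> f \<notin> N (Suc i)}"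

text \<open>The shallowest level comes first in the lexicographic comparison: a drop there allows
  arbitrary growth at deeper levels.\<close>

definition weight :: "(int \<Rightarrow> 'a) set \<Rightarrow> nat list" where
  "weight A = map (\<lambda>i. card (cosets A i)) [0..<M]"

lemma N_antimono: "i \<le> j \<Longrightarrow> N j \<subseteq> N i"
proof (induction j rule: dec_induct)
  case (step j)
  then show ?case using N_Suc[of j] by blast
qed simp

lemma N_0: "f \<in> N i \<Longrightarrow> f \<in> N 0"
  using N_antimono[of 0 i] by auto

lemma N_quo: "f \<in> N i \<Longrightarrow> g \<in> N i \<Longrightarrow> quo f g \<in> N i"
  unfolding quo_def by (intro N_mult N_inv)

lemma N_lquo: "f \<in> N i \<Longrightarrow> g \<in> N i \<Longrightarrow> lquo f g \<in> N i"
  unfolding lquo_def by (intro N_mult N_inv)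

lemma lquo_shift: "f \<in> N i \<Longrightarrow> lquo f (shift n f) \<in> N (Suc i)"
  unfolding lquo_def shift_def by (rule N_shift)

lemma shift_closed: "f \<in> N i \<Longrightarrow> shift n f m \<in> carrier G"
  using N_closed by (simp add: shift_def)

lemma shift_in_N:
  assumes "f \<in> N i"
  shows "shift n f \<in> N i"
proof -
  have "(\<lambda>m. f m \<otimes> lquo f (shift n f) m) \<in> N i"
    using lquo_shift[OF assms] N_Suc by (intro N_mult assms) blast
  also have "(\<lambda>m. f m \<otimes> lquo f (shift n f) m) = shift n f"
    using N_closed[OF assms] shift_closed[OF assms] by (simp add: lquo_def)
  finally show ?thesis .
qed

lemma shift_in_N_iff:
  assumes "f \<in> N 0"
  shows "shift n f \<in> N i \<longleftrightarrow> f \<in> N i"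
proof
  show "f \<in> N i" if "shift n f \<in> N i"
    using that
  proof (induction i)
    case (Suc i)
    then have f: "f \<in> N i" using N_Suc by blast
    have "(\<lambda>m. shift n f m \<otimes> inv (lquo f (shift n f) m)) \<in> N (Suc i)"
      by (intro N_mult N_inv Suc.prems lquo_shift f)
    also have "(\<lambda>m. shift n f m \<otimes> inv (lquo f (shift n f) m)) = f"
      using N_closed[OF assms] shift_closed[OF assms] by (simp add: lquo_def inv_mult_group)
    finally show ?case .
  qed (rule assms)
qed (rule shift_in_N)

lemma coset_eqI:
  assumes "f \<in> N i" "g \<in> N i" "lquo f g \<in> N (Suc i)"
  shows "coset i f = coset i g"
proof -
  note cl = N_closed[OF assms(1)] N_closed[OF assms(2)]
  have "lquo g u \<in> N (Suc i) \<longleftrightarrow> lquo f u \<in> N (Suc i)" if "u \<in> N i" for u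
  proof -
    have 1: "lquo g u = lquo (lquo f g) (lquo f u)" and 2: "lquo f u = (\<lambda>n. lquo f g n \<otimes> lquo g u n)"
      using cl N_closed[OF that] by (auto simp: lquo_def inv_mult_group m_assoc)
    show ?thesis
    proof
      assume "lquo g u \<in> N (Suc i)"
      then show "lquo f u \<in> N (Suc i)" by (subst 2) (rule N_mult[OF assms(3)])
    next
      assume "lquo f u \<in> N (Suc i)"
      then show "lquo g u \<in> N (Suc i)" by (subst 1) (rule N_lquo[OF assms(3)])
    qed
  qed
  then show ?thesis by (auto simp: coset_def)
qed

text \<open>Right division by \<open>p\<close> descends to cosets because \<open>N (Suc i)\<close>
  is stable under conjugation by \<open>p\<close>.\<close>

lemma coset_quo:
  assumes "f \<in> N i" "g \<in> N i" "lquo f g \<in> N (Suc i)" "p \<in> N i"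
  shows "coset i (quo f p) = coset i (quo g p)"
proof (rule coset_eqI)
  have "lquo (quo f p) (quo g p) = (\<lambda>n. p n \<otimes> lquo f g n \<otimes> inv (p n))"
    using N_closed[OF assms(1)] N_closed[OF assms(2)] N_closed[OF assms(4)]
    by (simp add: lquo_def quo_def inv_mult_group m_assoc)
  then show "lquo (quo f p) (quo g p) \<in> N (Suc i)"
    using N_conj[OF N_0[OF assms(4)] assms(3)] by simp
qed (use assms N_quo in auto)

lemma coset_self: "f \<in> N i \<Longrightarrow> f \<in> coset i f"
  using N_one[of "Suc i"] N_closed by (auto simp: coset_def lquo_def)

text \<open>The counts may already differ before \<open>b\<close>; the comparison is then decided at
  the first difference \<open>d\<close>, where the weak inequality is strict.\<close>

lemma weight_less:
  assumes "b < M" "\<And>i. i < b \<Longrightarrow> card (cosets B i) \<le> card (cosets A i)" "card (cosets B b) < card (cosets A b)"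
  shows "(weight B, weight A) \<in> lex less_than"
proof -
  define d where "d = (LEAST i. card (cosets B i) \<noteq> card (cosets A i))"
  have ne: "card (cosets B b) \<noteq> card (cosets A b)" using assms(3) by simp
  have d1: "card (cosets B d) \<noteq> card (cosets A d)" unfolding d_def by (rule LeastI) (rule ne)
  have d2: "d \<le> b" unfolding d_def by (rule Least_le) (rule ne)
  have d3: "card (cosets B i) = card (cosets A i)" if "i < d" for i
    using not_less_Least[of i "\<lambda>i. card (cosets B i) \<noteq> card (cosets A i)"] that unfolding d_def by blast
  have less: "card (cosets B d) < card (cosets A d)" 
    using d1 d2 assms(2)[of d] assms(3) by (cases "d = b") auto
  have split: "[0..<M] = [0..<d] @ d # [Suc d..<M]"
    using d2 assms(1) upt_add_eq_append[of 0 d "M - d"] upt_conv_Cons[of d M] by simp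
  have "map (\<lambda>i. card (cosets B i)) [0..<d] = map (\<lambda>i. card (cosets A i)) [0..<d]"
    using d3 by auto
  then have "weight B = map (\<lambda>i. card (cosets A i)) [0..<d] @ card (cosets B d) # map (\<lambda>i. card (cosets B i)) [Suc d..<M]"
    "weight A = map (\<lambda>i. card (cosets A i)) [0..<d] @ card (cosets A d) # map (\<lambda>i. card (cosets A i)) [Suc d..<M]"
    unfolding weight_def split by simp_all
  moreover have "(card (cosets B d), card (cosets A d)) \<in> less_than" using less by simp
  moreover have "length (weight B) = length (weight A)" by (simp add: weight_def)
  ultimately show ?thesis unfolding lex_conv by blast
qed

lemma nontrivial_not_in_N: "f \<noteq> (\<lambda>_. \<one>) \<Longrightarrow> f \<in> N i \<Longrightarrow> i < M"
proof (rule ccontr)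
  assume f: "f \<noteq> (\<lambda>_. \<one>)" "f \<in> N i" and "\<not> i < M"
  then have "f \<in> N M" using N_antimono[of M i] by auto
  then show False using f(1) unfolding N_trivial by simp
qed

text \<open>Above the deepest level \<open>b\<close>, shifting and dividing by \<open>p\<close> does
  not change the coset of a sequence, so no coset is gained. At level \<open>b\<close> division by
  \<open>p\<close> induces a map on cosets, and the coset of \<open>p\<close> itself is lost because
  its members fall into \<open>N (Suc b)\<close>.\<close>

lemma weight_less_deepest:
  assumes A: "finite A" "A \<subseteq> N 0" and p: "p \<in> A" "p \<in> N b" "p \<noteq> (\<lambda>_. \<one>)" and deep: "A \<inter> N (Suc b) = {}"
    and B: "\<And>h. h \<in> B \<Longrightarrow> \<exists>f\<in>A. \<exists>n. h = quo (shift n f) p"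
  shows "(weight B, weight A) \<in> lex less_than"
proof (rule weight_less)
  show "b < M" using nontrivial_not_in_N p by blast
  have key: "\<exists>f\<in>A. \<exists>n. h = quo (shift n f) p \<and> f \<in> N i"
    if hB: "h \<in> B" "h \<in> N i" "i \<le> b" for h i
  proof -
    obtain f n where f: "f \<in> A" "h = quo (shift n f) p" using B[OF hB(1)] by blast
    have f0: "f \<in> N 0" using f A by auto
    have "(\<lambda>m. h m \<otimes> p m) \<in> N i" using hB p N_antimono[of i b] by (intro N_mult) auto
    also have "(\<lambda>m. h m \<otimes> p m) = shift n f"
      using N_closed[OF p(2)] shift_closed[OF f0] by (simp add: f quo_def m_assoc)
    finally show ?thesis using f shift_in_N_iff[OF f0] by blast
  qed
  show "card (cosets B i) \<le> card (cosets A i)" if i: "i < b" for i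
  proof (rule card_mono)
    show "finite (cosets A i)" using A by (simp add: cosets_def)
    show "cosets B i \<subseteq> cosets A i"
    proof
      fix C assume "C \<in> cosets B i"
      then obtain h where h: "h \<in> B" "h \<in> N i" "h \<notin> N (Suc i)" "C = coset i h" by (auto simp: cosets_def)
      then obtain f n where f: "f \<in> A" "h = quo (shift n f) p" "f \<in> N i" using key[OF h(1,2)] i by auto
      have p': "p \<in> N (Suc i)" using p N_antimono[of "Suc i" b] i by auto
      have "f \<notin> N (Suc i)" using h f N_quo[OF shift_in_N p'] by blast
      moreover have "coset i f = coset i h"
      proof (rule coset_eqI)
        have "lquo f h = quo (lquo f (shift n f)) p"
          using N_closed[OF f(3)] shift_closed[OF f(3)] N_closed[OF p(2)]
          by (simp add: f(2) lquo_def quo_def m_assoc)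
        then show "lquo f h \<in> N (Suc i)" using N_quo[OF lquo_shift[OF f(3)] p'] by simp
      qed (use f h in auto)
      ultimately show "C \<in> cosets A i" using h f by (auto simp: cosets_def)
    qed
  qed
  \<comment> \<open>The map induced by right division by \<open>p\<close>; by
    \<open>coset_quo\<close> the choice of representative in \<open>C\<close> is immaterial.\<close>
  define F where "F C = coset b (quo (SOME u. u \<in> C) p)" for C
  have pb: "p \<notin> N (Suc b)" using p deep by blast
  have "cosets B b \<subseteq> F ` (cosets A b - {coset b p})"
  proof
    fix C assume "C \<in> cosets B b"
    then obtain h where h: "h \<in> B" "h \<in> N b" "h \<notin> N (Suc b)" "C = coset b h" by (auto simp: cosets_def)
    then obtain f n where f: "f \<in> A" "h = quo (shift n f) p" "f \<in> N b" using key[OF h(1,2)] by auto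
    have cl: "f m \<in> carrier G" "shift n f m \<in> carrier G" "p m \<in> carrier G" for m 
      using N_closed[OF f(3)] shift_closed[OF f(3)] N_closed[OF p(2)] by auto
    have "coset b f \<noteq> coset b p"
    proof
      assume "coset b f = coset b p"
      then have "lquo f p \<in> N (Suc b)" using coset_self[OF p(2)] by (auto simp: coset_def)
      then have "(\<lambda>m. f m \<otimes> quo (lquo f (shift n f)) (lquo f p) m \<otimes> inv (f m)) \<in> N (Suc b)"
        by (intro N_conj N_quo lquo_shift f N_0[OF f(3)])
      also have "(\<lambda>m. f m \<otimes> quo (lquo f (shift n f)) (lquo f p) m \<otimes> inv (f m)) = h"
        using cl by (simp add: f(2) quo_def lquo_def inv_mult_group m_assoc)
      finally show False using h by blast
    qed
    moreover have "f \<notin> N (Suc b)" using deep f by blast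
    ultimately have "coset b f \<in> cosets A b - {coset b p}" using f by (auto simp: cosets_def)
    moreover have "F (coset b f) = C"
    proof -
      define u where "u = (SOME u. u \<in> coset b f)"
      have "u \<in> coset b f" unfolding u_def
        by (rule someI[of "\<lambda>u. u \<in> coset b f" f, OF coset_self[OF f(3)]])
      then have u: "u \<in> N b" "lquo f u \<in> N (Suc b)" by (auto simp: coset_def)
      have "coset b (quo f p) = coset b (quo u p)"
        by (rule coset_quo[OF f(3) u p(2)])
      moreover have "coset b (quo f p) = coset b h" unfolding f(2)
        by (rule coset_quo[OF f(3) shift_in_N[OF f(3)] lquo_shift[OF f(3)] p(2)])
      ultimately show ?thesis unfolding F_def u_def[symmetric] h(4) by simp
    qed
    ultimately show "C \<in> F ` (cosets A b - {coset b p})" by blast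
  qed
  moreover have fin: "finite (cosets A b)" using A by (simp add: cosets_def)
  ultimately have "card (cosets B b) \<le> card (cosets A b - {coset b p})"
    by (meson card_image_le card_mono finite_Diff finite_imageI le_trans)
  also have "\<dots> < card (cosets A b)"
    using fin p pb by (intro card_Diff1_less) (auto simp: cosets_def)
  finally show "card (cosets B b) < card (cosets A b)" .
qed

text \<open>The quotient of a shift of \<open>f\<close> by \<open>f\<close> lies one level deeper
  than \<open>f\<close>, so the shallowest level occurring in \<open>A\<close> is emptied.\<close>

lemma weight_less_self:
  assumes A: "finite A" "A \<subseteq> N 0 - {\<lambda>_. \<one>}" "A \<noteq> {}"
    and B: "\<And>h. h \<in> B \<Longrightarrow> \<exists>f\<in>A. \<exists>n. h = quo (shift n f) f"
  shows "(weight B, weight A) \<in> lex less_than"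
proof -
  \<comment> \<open>The shallowest level occurring in \<open>A\<close>.\<close>
  define a where "a = (LEAST i. \<not> A \<subseteq> N (Suc i))"
  have ex: "\<not> A \<subseteq> N (Suc M)"
  proof
    assume "A \<subseteq> N (Suc M)"
    then have "A \<subseteq> {\<lambda>_. \<one>}" using N_Suc[of M] unfolding N_trivial by (rule subset_trans)
    then show False using A by blast
  qed
  have a1: "\<not> A \<subseteq> N (Suc a)" unfolding a_def by (rule LeastI) (rule ex)
  have a2: "A \<subseteq> N a"
  proof (cases a)
    case (Suc a')
    then show ?thesis using not_less_Least[of a' "\<lambda>i. \<not> A \<subseteq> N (Suc i)"] unfolding a_def by auto
  qed (use A in auto)
  obtain f where f: "f \<in> A" "f \<in> N a" "f \<notin> N (Suc a)" using a1 a2 by blast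
  have BN: "B \<subseteq> N (Suc a)"
  proof
    fix h assume "h \<in> B"
    then obtain g n where g: "g \<in> A" "h = quo (shift n g) g" using B[OF \<open>h \<in> B\<close>] by blast
    have ga: "g \<in> N a" using g a2 by blast
    have "h = (\<lambda>m. g m \<otimes> lquo g (shift n g) m \<otimes> inv (g m))"
      using N_closed[OF ga] shift_closed[OF ga] by (simp add: g(2) quo_def lquo_def)
    then show "h \<in> N (Suc a)" using N_conj[OF N_0[OF ga] lquo_shift[OF ga]] by simp
  qed
  have empty: "cosets B i = {}" if "i \<le> a" for i
    using BN N_antimono[of "Suc i" "Suc a"] that by (auto simp: cosets_def)
  show ?thesis
  proof (rule weight_less)
    show "a < M" using f A nontrivial_not_in_N by blast
    show "card (cosets B i) \<le> card (cosets A i)" if "i < a" for i using empty[of i] that by simp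
    have "cosets A a \<noteq> {}" "finite (cosets A a)" using f A by (auto simp: cosets_def)
    then show "card (cosets B a) < card (cosets A a)" using empty[of a] by (simp add: card_gt_0_iff)
  qed
qed

end

section \<open>PET induction\<close>

text \<open>The central \<open>z\<close> steers points without disturbing the sequences.
  \<open>periodic_trivial\<close> is how torsion-freeness of the group enters.\<close>

locale mixing_chain = mixing_system G E \<phi> X + seq_chain G N M
  for G (structure) and E :: "'x set" and \<phi> and X and N and M +
  fixes z :: 'a
  assumes z_closed: "z \<in> carrier G" and z_neq_one: "z \<noteq> \<one>"
    and z_central: "g \<in> carrier G \<Longrightarrow> z \<otimes> g = g \<otimes> z"
    and periodic_trivial: "f \<in> N 0 \<Longrightarrow> t \<noteq> 0 \<Longrightarrow> (\<And>m. f (m + t) = f m) \<Longrightarrow> f = (\<lambda>_. \<one>)"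
begin

text \<open>The requests in \<open>Q\<close> share the time but each has its own point. Allowing
  several is what lets \<open>singly\<close> be reduced to \<open>jointly\<close> of smaller weight:
  requests on different sequences become requests on one system \<open>B\<close>.\<close>

definition jointly :: "(int \<Rightarrow> 'a) set \<Rightarrow> bool" where
  "jointly A \<longleftrightarrow> (\<forall>Q. finite Q \<longrightarrow> (\<forall>(V, U)\<in>Q. ne_open V \<and> (\<forall>f\<in>A. ne_open (U f))) \<longrightarrow>
     (\<exists>n. \<forall>(V, U)\<in>Q. \<exists>x\<in>V. \<forall>f\<in>A. \<phi> (f n) x \<in> U f))"

definition singly :: "(int \<Rightarrow> 'a) set \<Rightarrow> bool" where
  "singly A \<longleftrightarrow> (\<forall>R. finite R \<longrightarrow> (\<forall>(f, V, U)\<in>R. f \<in> A \<and> ne_open V \<and> ne_open U) \<longrightarrow>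
     (\<exists>n. \<forall>(f, V, U)\<in>R. meets (f n) V U))"

text \<open>For \<open>f\<close> in \<open>N 0\<close> this says
  \<open>f (m + t) = f t \<otimes> f m\<close>, so \<open>f\<close> is a homomorphism on the
  multiples of \<open>t\<close>.\<close>

definition quasi_hom :: "(int \<Rightarrow> 'a) \<Rightarrow> bool" where
  "quasi_hom f \<longleftrightarrow> (\<exists>t\<noteq>0. shift t f = f)"

lemma shift_fix_iterate:
  assumes f: "f \<in> N 0" and t: "shift t f = f"
  shows "f (m + k * t) = f t [^] (k::int) \<otimes> f m"
proof -
  have cl: "f m \<in> carrier G" for m using N_closed[OF f] .
  have step: "f (m + t) = f t \<otimes> f m" for m
  proof -
    have "inv (f t) \<otimes> f (m + t) = f m" using fun_cong[OF t, of m] by (simp add: shift_def)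
    then show ?thesis using cl by (metis inv_mult_cancel(2))
  qed
  have nat: "f (m + int k * t) = f t [^] int k \<otimes> f m" for m k
  proof (induction k)
    case (Suc k)
    have "f (m + int (Suc k) * t) = f t \<otimes> f (m + int k * t)"
      using step[of "m + int k * t"] by (simp add: algebra_simps)
    also have "\<dots> = (f t \<otimes> f t [^] k) \<otimes> f m" using Suc cl by (simp add: int_pow_int m_assoc)
    also have "f t \<otimes> f t [^] k = f t [^] int (Suc k)"
      unfolding int_pow_int using cl by (metis nat_pow_Suc2)
    finally show ?case .
  qed (use cl in simp)
  show ?thesis
  proof (cases "k \<ge> 0")
    case True
    then show ?thesis using nat[of m "nat k"] by simp
  next
    case False
    then have "f m = f t [^] (- k) \<otimes> f (m + k * t)" using nat[of "m + k * t" "nat (- k)"] by simp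
    then have "f m = inv (f t [^] k) \<otimes> f (m + k * t)" using cl by (simp add: int_pow_neg)
    then show ?thesis using cl by simp
  qed
qed

lemma shift_fix_pow:
  assumes f: "f \<in> N 0" and t: "shift t f = f"
  shows "f (k * t) = f t [^] (k::int)"
  using shift_fix_iterate[OF assms, of 0 k] N_zero[OF f] N_closed[OF f] by simp

lemma shift_fix_mult:
  assumes f: "f \<in> N 0" and t: "shift t f = f"
  shows "shift (k * t) f = f"
proof
  show "shift (k * t) f m = f m" for m
    using shift_fix_iterate[OF assms, of m k] shift_fix_pow[OF assms, of k] N_closed[OF f]
    by (simp add: shift_def)
qed

text \<open>Makes \<open>f t\<close> an element to which covering and mixing apply.\<close>

lemma shift_fix_value_neq_one:
  assumes f: "f \<in> N 0" "f \<noteq> (\<lambda>_. \<one>)" and t: "shift t f = f" "t \<noteq> 0"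
  shows "f t \<noteq> \<one>"
proof
  assume "f t = \<one>"
  then have "f (m + t) = f m" for m
    using shift_fix_iterate[OF f(1) t(1), of m 1] N_closed[OF f(1)] by simp
  then show False using periodic_trivial[OF f(1) t(2)] f(2) by blast
qed

text \<open>Coinciding shifts give \<open>f (m + (n - n')) = c \<otimes> f m\<close>, and
  \<open>f 0 = \<one>\<close> identifies \<open>c\<close> as \<open>f (n - n')\<close>.\<close>

lemma shift_inj:
  assumes f: "f \<in> N 0" and n: "shift n f = shift n' f" "n \<noteq> n'"
  shows "quasi_hom f"
proof -
  have cl: "f m \<in> carrier G" for m using N_closed[OF f] .
  define c where "c = f n \<otimes> inv (f n')"
  have "f (m + (n - n')) = c \<otimes> f m" for m
  proof -
    have "inv (f n) \<otimes> f (m + (n - n')) = inv (f n') \<otimes> f m"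
      using fun_cong[OF n(1), of "m - n'"] by (simp add: shift_def algebra_simps)
    then have "f (m + (n - n')) = f n \<otimes> (inv (f n') \<otimes> f m)" using cl by (metis inv_mult_cancel(2))
    then show ?thesis using cl by (simp add: c_def m_assoc)
  qed
  moreover from this[of 0] have "f (n - n') = c" using N_zero[OF f] cl by (simp add: c_def)
  ultimately have "shift (n - n') f = f"
    using cl by (auto simp: shift_def fun_eq_iff c_def)
  then show ?thesis using n(2) unfolding quasi_hom_def by (intro exI[of _ "n - n'"]) simp
qed

text \<open>Evaluation at \<open>- n\<close> recovers \<open>f n\<close>, since
  \<open>f 0 = \<one>\<close>; then the whole sequence follows.\<close>

lemma shift_inj2:
  assumes f: "f \<in> N 0" and g: "g \<in> N 0" and n: "shift n f = shift n g"
  shows "f = g"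
proof -
  have cl: "f m \<in> carrier G" "g m \<in> carrier G" for m using N_closed[OF f] N_closed[OF g] by auto
  have "f n = g n"
    using fun_cong[OF n, of "- n"] N_zero[OF f] N_zero[OF g] cl by (simp add: shift_def) (metis inv_inv)
  then have "f m = g m" for m
  proof -
    have "inv (f n) \<otimes> f m = inv (f n) \<otimes> g m"
      using fun_cong[OF n, of "m - n"] \<open>f n = g n\<close> by (simp add: shift_def)
    then show ?thesis using cl by (metis inv_mult_cancel(2))
  qed
  then show ?thesis by blast
qed

lemma quo_inj:
  assumes "f \<in> N 0" "g \<in> N 0" "p \<in> N 0" "quo f p = quo g p"
  shows "f = g"
proof
  fix n
  show "f n = g n"
    using fun_cong[OF assms(4), of n] N_closed[OF assms(1), of n] N_closed[OF assms(2), of n]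
      N_closed[OF assms(3), of n] right_cancel[of "inv (p n)" "f n" "g n"] by (simp add: quo_def)
qed

lemma common_shift:
  assumes "finite A" "A \<subseteq> N 0" "\<forall>f\<in>A. quasi_hom f"
  shows "\<exists>t\<noteq>0. \<forall>f\<in>A. shift t f = f"
  using assms
proof (induction A rule: finite_induct)
  case empty
  then show ?case by (intro exI[of _ 1]) simp
next
  case (insert f A)
  then obtain t where t: "t \<noteq> 0" "\<forall>f\<in>A. shift t f = f" by auto
  obtain s where s: "s \<noteq> 0" "shift s f = f" using insert.prems unfolding quasi_hom_def by auto
  have "shift (s * t) g = g" if "g \<in> insert f A" for g
  proof (cases "g = f")
    case True
    then show ?thesis using shift_fix_mult[of f s t] s insert.prems by (simp add: mult.commute)
  next
    case False
    then show ?thesis using shift_fix_mult[of g t s] t insert.prems that by auto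
  qed
  then show ?case using s t by (intro exI[of _ "s * t"]) auto
qed

text \<open>Along multiples of a common \<open>t\<close> the sequences are powers of the elements
  \<open>f t\<close>. A run of \<open>card F + 1\<close> good exponents contains a time outside
  \<open>F\<close>; avoiding \<open>F\<close> keeps the shifts of the remaining sequences
  distinct.\<close>

lemma quasi_hom_meets:
  assumes R: "finite R" "\<forall>(f, V, U)\<in>R. f \<in> N 0 \<and> f \<noteq> (\<lambda>_. \<one>) \<and> quasi_hom f \<and> ne_open V \<and> ne_open U"
    and F: "finite F"
  shows "\<exists>n. (\<forall>(f, V, U)\<in>R. meets (f n) V U) \<and> n \<notin> F"
proof -
  have "\<exists>t\<noteq>0. \<forall>f\<in>fst ` R. shift t f = f"
    using R by (intro common_shift) auto
  then obtain t where t0: "t \<noteq> 0" "\<forall>f\<in>fst ` R. shift t f = f" by blast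
  have "shift t f = f" if "(f, V, U) \<in> R" for f V U
    using bspec[OF t0(2) rev_image_eqI[OF that]] by simp
  note t = t0(1) this
  let ?R = "(\<lambda>(f, V, U). (f t, V, U)) ` R"
  have "\<exists>m::int. \<forall>i\<in>{0..int (card F)}. \<forall>(c, V, U)\<in>?R. meets (c [^] (m + i)) V U"
  proof (rule meets_simultaneously_run)
    show "fst ` ?R \<subseteq> carrier G - {\<one>}"
    proof clarsimp
      fix f V U assume f: "(f, V, U) \<in> R"
      then have "f \<in> N 0" "f \<noteq> (\<lambda>_. \<one>)" using R(2) by auto
      then show "f t \<in> carrier G \<and> f t \<noteq> \<one>" using t(1) t(2)[OF f] N_closed shift_fix_value_neq_one by blast
    qed
    show "\<forall>(c, V, U)\<in>?R. c \<in> fst ` ?R \<and> ne_open V \<and> ne_open U" using R(2) by force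
  qed (use R in auto)
  then obtain m :: int where m: "\<forall>i\<in>{0..int (card F)}. \<forall>(c, V, U)\<in>?R. meets (c [^] (m + i)) V U" ..
  let ?I = "(\<lambda>i. (m + i) * t) ` {0..int (card F)}"
  have "card ?I = Suc (card F)" using t(1) by (subst card_image) (auto simp: inj_on_def)
  then have "\<not> ?I \<subseteq> F" using card_mono[OF F, of ?I] by auto
  then obtain i where i: "i \<in> {0..int (card F)}" "(m + i) * t \<notin> F" by blast
  have "meets (f ((m + i) * t)) V U" if "(f, V, U) \<in> R" for f V U
  proof -
    have "(f t, V, U) \<in> ?R" by (rule rev_image_eqI[OF that]) simp
    then have "meets (f t [^] (m + i)) V U" using m i(1) by blast
    then show ?thesis using shift_fix_pow[of f t "m + i"] t(2)[OF that] R(2) that by auto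
  qed
  then show ?thesis using i(2) by blast
qed

lemma common_cover:
  assumes "finite Q" "\<forall>q\<in>Q. ne_open (V q)"
  shows "\<exists>l\<ge>0. \<forall>q\<in>Q. \<forall>x\<in>E. \<exists>j\<in>{0..l}. \<phi> (z [^] (j::int)) x \<in> V q"
  using assms
proof (induction Q rule: finite_induct)
  case (insert q Q)
  obtain l where l: "l \<ge> 0" "\<forall>q\<in>Q. \<forall>x\<in>E. \<exists>j\<in>{0..l}. \<phi> (z [^] (j::int)) x \<in> V q" using insert by auto
  obtain l' where l': "\<forall>x\<in>E. \<exists>j\<in>{0..l'}. \<phi> (z [^] (j::int)) x \<in> V q"
    using cover[OF z_closed z_neq_one, of "V q"] insert.prems unfolding ne_open_def by auto
  have "\<exists>j\<in>{0..max l l'}. \<phi> (z [^] (j::int)) x \<in> V q'" if q': "q' \<in> insert q Q" and x: "x \<in> E" for x q'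
  proof (cases "q' = q")
    case True
    obtain j where "j \<in> {0..l'}" "\<phi> (z [^] (j::int)) x \<in> V q" using l' x by blast
    then show ?thesis using True by (intro bexI[of _ j]) auto
  next
    case False
    then obtain j where "j \<in> {0..l}" "\<phi> (z [^] (j::int)) x \<in> V q'" using l(2) x q' by blast
    then show ?thesis by (intro bexI[of _ j]) auto
  qed
  then show ?case using l(1) by (intro exI[of _ "max l l'"]) auto
qed auto

text \<open>The points that, once moved by \<open>h(m)\<close>, satisfy all requirements attached to the function \<open>h\<close>
  by the substitution in the lemma \<open>reduction\<close> below.\<close>

definition target ::
  "'j set \<Rightarrow> ('j \<Rightarrow> int) \<Rightarrow> ('j \<Rightarrow> int) \<Rightarrow> (int \<Rightarrow> 'a) set \<Rightarrow> (int \<Rightarrow> 'a) \<Rightarrow> ((int \<Rightarrow> 'a) \<Rightarrow> 'x set) \<Rightarrow> 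
    (int \<Rightarrow> 'a) \<Rightarrow> 'x set" where
  "target \<J> \<nu> e A p U h = {x \<in> E. \<forall>f\<in>A. \<forall>J\<in>\<J>. quo (shift (\<nu> J) f) p = h \<longrightarrow> \<phi> (z [^] e J \<otimes> f (\<nu> J)) x \<in> U f}"

lemma z_pow_central:
  assumes "g \<in> carrier G" 
  shows "z [^] (j::int) \<otimes> g = g \<otimes> z [^] j"
proof -
  have nat: "z [^] (n::nat) \<otimes> g = g \<otimes> z [^] n" for n
  proof (induction n)
    case (Suc n)
    have "z [^] Suc n \<otimes> g = z [^] n \<otimes> (z \<otimes> g)" using assms z_closed by (simp add: m_assoc)
    also have "\<dots> = (z [^] n \<otimes> g) \<otimes> z" using assms z_closed by (simp add: z_central m_assoc)
    also have "\<dots> = g \<otimes> z [^] Suc n" using assms z_closed Suc by (simp add: m_assoc)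
    finally show ?case .
  qed (use assms in simp)
  show ?thesis
  proof (cases "j \<ge> 0")
    case True
    then show ?thesis using nat[of "nat j"] by (simp flip: int_pow_int)
  next
    case False
    let ?w = "z [^] nat (- j)"
    have w: "?w \<in> carrier G" using z_closed by simp
    have j: "z [^] j = inv ?w" using False z_closed int_pow_neg[of z "- j"] int_pow_int[of G z "nat (- j)"] by simp
    have "inv ?w \<otimes> g = inv ?w \<otimes> (g \<otimes> ?w) \<otimes> inv ?w" using w assms by (simp add: m_assoc)
    also have "\<dots> = g \<otimes> inv ?w" using w assms by (simp add: m_assoc flip: nat)
    finally show ?thesis unfolding j .
  qed
qed

text \<open>The substitution \<open>n = m + \<nu>(J)\<close>, \<open>x = z\<^sup>j p(m)\<^sup>-\<^sup>1 y\<close>, where the power of the central element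
  brings the point into \<open>V\<close>; the tuple \<open>J\<close> of the exponents needed is known only after \<open>m\<close> and \<open>y\<close>,
  so all finitely many tuples are prepared for.\<close>

lemma reduction:
  fixes Q :: "'q set"
  assumes Q: "finite Q" and V: "\<And>q. q \<in> Q \<Longrightarrow> ne_open (V q)" 
    and A: "\<And>q. q \<in> Q \<Longrightarrow> A q \<subseteq> N 0" and p: "\<And>q. q \<in> Q \<Longrightarrow> p q \<in> N 0"
    and U: "\<And>q f. q \<in> Q \<Longrightarrow> f \<in> A q \<Longrightarrow> ne_open (U q f)"
    and l: "\<forall>q\<in>Q. \<forall>x\<in>E. \<exists>j\<in>{0..l}. \<phi> (z [^] (j::int)) x \<in> V q"
    and good: "\<And>q h. q \<in> Q \<Longrightarrow> ne_open (target (Pi\<^sub>E Q (\<lambda>_. {0..l})) \<nu> (\<lambda>J. J q) (A q) (p q) (U q) h)"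
    and B: "jointly B" "\<And>q f J. q \<in> Q \<Longrightarrow> f \<in> A q \<Longrightarrow> J \<in> Pi\<^sub>E Q (\<lambda>_. {0..l}) \<Longrightarrow> 
      quo (shift (\<nu> J) f) (p q) \<noteq> (\<lambda>_. \<one>) \<Longrightarrow> quo (shift (\<nu> J) f) (p q) \<in> B"
  shows "\<exists>n. \<forall>q\<in>Q. \<exists>x\<in>V q. \<forall>f\<in>A q. \<phi> (f n) x \<in> U q f"
proof -
  let ?\<J> = "Pi\<^sub>E Q (\<lambda>_. {0..l})"
  define W where "W q = target ?\<J> \<nu> (\<lambda>J. J q) (A q) (p q) (U q)" for q
  \<comment> \<open>The trivial sequence is not in \<open>B\<close>, so what is required of it is
    imposed on the starting point \<open>y\<close> instead.\<close>
  let ?Q = "(\<lambda>q. (W q (\<lambda>_. \<one>), W q)) ` Q"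
  have "\<exists>n. \<forall>(V, U)\<in>?Q. \<exists>x\<in>V. \<forall>f\<in>B. \<phi> (f n) x \<in> U f"
    using B(1)[unfolded jointly_def, rule_format, of ?Q] Q good by (auto simp: W_def)
  then obtain m where m: "\<forall>q\<in>Q. \<exists>y\<in>W q (\<lambda>_. \<one>). \<forall>h\<in>B. \<phi> (h m) y \<in> W q h" by auto
  then obtain y where y: "\<And>q. q \<in> Q \<Longrightarrow> y q \<in> W q (\<lambda>_. \<one>)" "\<And>q h. q \<in> Q \<Longrightarrow> h \<in> B \<Longrightarrow> \<phi> (h m) (y q) \<in> W q h"
    by metis
  have yE: "y q \<in> E" if "q \<in> Q" for q using y(1)[OF that] by (simp add: W_def target_def)
  have pcl: "p q n \<in> carrier G" if "q \<in> Q" for q n using N_closed[OF p[OF that]] .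
  have "\<exists>j. \<forall>q\<in>Q. j q \<in> {0..l} \<and> \<phi> (z [^] j q) (\<phi> (inv (p q m)) (y q)) \<in> V q"
    using l yE pcl act_closed by (intro bchoice) (simp add: Bex_def)
  then obtain j where j: "\<And>q. q \<in> Q \<Longrightarrow> j q \<in> {0..l}" 
    "\<And>q. q \<in> Q \<Longrightarrow> \<phi> (z [^] j q) (\<phi> (inv (p q m)) (y q)) \<in> V q" by blast
  define J where "J = restrict j Q"
  have J: "J \<in> ?\<J>" "\<And>q. q \<in> Q \<Longrightarrow> J q = j q" using j(1) by (auto simp: J_def)
  have "\<phi> (f (m + \<nu> J)) (\<phi> (z [^] j q) (\<phi> (inv (p q m)) (y q))) \<in> U q f" if q: "q \<in> Q" and f: "f \<in> A q" for q f
  proof -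
    define h where "h = quo (shift (\<nu> J) f) (p q)"
    have f0: "f \<in> N 0" using A q f by blast
    have cl: "f n \<in> carrier G" for n using N_closed[OF f0] .
    have hcl: "h n \<in> carrier G" for n using cl pcl[OF q] by (simp add: h_def quo_def shift_def)
    have "\<phi> (h m) (y q) \<in> W q h"
    proof (cases "h = (\<lambda>_. \<one>)")
      case True
      then show ?thesis using y(1)[OF q] act_one[OF yE[OF q]] by simp
    next
      case False
      then show ?thesis using y(2)[OF q] B(2)[OF q f J(1)] by (simp add: h_def)
    qed
    then have "\<phi> (z [^] J q \<otimes> f (\<nu> J)) (\<phi> (h m) (y q)) \<in> U q f"
      using f J(1) unfolding W_def target_def h_def by blast
    then have "\<phi> (z [^] j q \<otimes> f (\<nu> J)) (\<phi> (h m) (y q)) \<in> U q f"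
      using J(2)[OF q] by simp
    also have "\<phi> (z [^] j q \<otimes> f (\<nu> J)) (\<phi> (h m) (y q)) = \<phi> ((z [^] j q \<otimes> f (\<nu> J)) \<otimes> h m) (y q)"
      using cl z_closed hcl yE[OF q] by (simp add: act_mult)
    \<comment> \<open>The factor \<open>f (\<nu> J)\<close> cancels against the normalisation of the
      shift, and the central power moves past \<open>f (m + \<nu> J)\<close>.\<close>
    also have "(z [^] j q \<otimes> f (\<nu> J)) \<otimes> h m = f (m + \<nu> J) \<otimes> (z [^] j q \<otimes> inv (p q m))"
    proof -
      have "(z [^] j q \<otimes> f (\<nu> J)) \<otimes> h m = (z [^] j q \<otimes> f (m + \<nu> J)) \<otimes> inv (p q m)"
        using cl pcl[OF q] z_closed by (simp add: h_def quo_def shift_def m_assoc)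
      then show ?thesis using cl pcl[OF q] z_closed by (simp add: z_pow_central m_assoc)
    qed
    also have "\<phi> \<dots> (y q) = \<phi> (f (m + \<nu> J)) (\<phi> (z [^] j q) (\<phi> (inv (p q m)) (y q)))"
      using cl z_closed pcl[OF q] yE[OF q] act_closed by (simp add: act_mult)
    finally show ?thesis .
  qed
  then show ?thesis using j(2) by blast
qed

lemma choice_of_shifts:
  fixes Q :: "'q set" and \<J> :: "('q \<Rightarrow> int) set"
  assumes Q: "finite Q"
    and A: "\<And>q. q \<in> Q \<Longrightarrow> finite (A q)" "\<And>q. q \<in> Q \<Longrightarrow> A q \<subseteq> N 0" and p: "\<And>q. q \<in> Q \<Longrightarrow> p q \<in> N 0"
    and U: "\<And>q f. q \<in> Q \<Longrightarrow> f \<in> A q \<Longrightarrow> ne_open (U q f)"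
    and ext: "\<And>R F. finite R \<Longrightarrow> \<forall>(f, V, U)\<in>R. f \<in> L \<and> ne_open V \<and> ne_open U \<Longrightarrow> finite F \<Longrightarrow>
      \<exists>n. (\<forall>(f, V, U)\<in>R. meets (f n) V U) \<and> (\<forall>f\<in>K. \<forall>n'\<in>F. shift n f \<noteq> shift n' f)"
    and AL: "\<And>q. q \<in> Q \<Longrightarrow> A q \<subseteq> L \<or> (\<exists>f\<in>K. A q = {f})"
    and \<J>: "finite \<J>"
  shows "\<exists>\<nu>. \<forall>q\<in>Q. \<forall>h. ne_open (target \<J> \<nu> (\<lambda>J. J q) (A q) (p q) (U q) h)"
  using \<J>
proof (induction \<J> rule: finite_induct)
  case empty
  then show ?case using ne_open_E by (simp add: target_def)
next
  case (insert J \<J>)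
  then obtain \<nu> where \<nu>: "\<And>q h. q \<in> Q \<Longrightarrow> ne_open (target \<J> \<nu> (\<lambda>J. J q) (A q) (p q) (U q) h)" by blast
  define W where "W q h = target \<J> \<nu> (\<lambda>J. J q) (A q) (p q) (U q) h" for q h
  have W: "ne_open (W q h)" if "q \<in> Q" for q h using \<nu>[OF that] by (simp add: W_def)
  \<comment> \<open>Which \<open>h\<close> the sequence \<open>f\<close> will serve depends on the
    time still to be chosen, so every value of \<open>W q\<close> is requested; these are finitely
    many, since all but finitely many targets equal \<open>E\<close>.\<close>
  define R where "R = (\<Union>q\<in>Q. \<Union>f\<in>A q \<inter> L. (\<lambda>w. (f, w, pre (z [^] J q) (U q f))) ` range (W q))"
  have "finite (range (W q))" if "q \<in> Q" for q
  proof (rule finite_subset)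
    let ?H = "(\<lambda>(f, J). quo (shift (\<nu> J) f) (p q)) ` (A q \<times> \<J>)"
    show "range (W q) \<subseteq> insert E (W q ` ?H)"
    proof
      fix w assume "w \<in> range (W q)"
      then obtain h where h: "w = W q h" by blast
      show "w \<in> insert E (W q ` ?H)"
      proof (cases "h \<in> ?H")
        case False
        then have "w = E" unfolding h W_def target_def by force
        then show ?thesis by simp
      qed (use h in blast)
    qed
    show "finite (insert E (W q ` ?H))" using A(1)[OF that] insert.hyps by simp
  qed
  then have "finite R" unfolding R_def using Q A(1) by blast
  moreover have "\<forall>(f, V, U)\<in>R. f \<in> L \<and> ne_open V \<and> ne_open U"
    unfolding R_def using W U z_closed by (auto intro!: ne_open_pre)
  ultimately obtain n where n: "\<And>f V U. (f, V, U) \<in> R \<Longrightarrow> meets (f n) V U" 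
    "\<And>f n'. f \<in> K \<Longrightarrow> n' \<in> \<nu> ` \<J> \<Longrightarrow> shift n f \<noteq> shift n' f"
    using ext[of R "\<nu> ` \<J>"] insert.hyps(1) by blast
  have "ne_open (target (insert J \<J>) (\<nu>(J := n)) (\<lambda>J. J q) (A q) (p q) (U q) h)" if q: "q \<in> Q" for q h
  proof -
    let ?T = "{x \<in> E. \<forall>f\<in>A q. quo (shift n f) (p q) = h \<longrightarrow> \<phi> (z [^] J q \<otimes> f n) x \<in> U q f}"
    have "(\<nu>(J := n)) J' = \<nu> J'" if "J' \<in> \<J>" for J' using that insert.hyps(2) by auto
    then have eq: "target (insert J \<J>) (\<nu>(J := n)) (\<lambda>J. J q) (A q) (p q) (U q) h = W q h \<inter> ?T"
      unfolding W_def target_def by auto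
    show ?thesis
    proof (cases "\<exists>f\<in>A q. quo (shift n f) (p q) = h")
      case False
      then have "W q h \<inter> ?T = W q h" using ne_open_subset[OF W[OF q]] by auto
      then show ?thesis using eq W[OF q] by simp
    next
      case True
      then obtain f where f: "f \<in> A q" "quo (shift n f) (p q) = h" by blast
      have N0: "g \<in> N 0" if "g \<in> A q" for g using A(2)[OF q] that by blast
      \<comment> \<open>Shifting and dividing are injective, so the new tuple adds at most one
        constraint to each target.\<close>
      have uniq: "g = f" if "g \<in> A q" "quo (shift n g) (p q) = h" for g
        using that f N0 p[OF q] by (metis quo_inj shift_in_N shift_inj2)
      have "(\<forall>g\<in>A q. quo (shift n g) (p q) = h \<longrightarrow> \<phi> (z [^] J q \<otimes> g n) x \<in> U q g) \<longleftrightarrow>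
          \<phi> (z [^] J q \<otimes> f n) x \<in> U q f" for x
        using f uniq by blast
      then have T: "?T = pre (z [^] J q \<otimes> f n) (U q f)"
        unfolding pre_def by simp
      have fn: "f n \<in> carrier G" using N_closed[OF N0[OF f(1)]] .
      have g: "z [^] J q \<otimes> f n \<in> carrier G" using fn z_closed by simp
      have "meets (z [^] J q \<otimes> f n) (W q h) (U q f)"
      proof (cases "f \<in> L")
        case True
        then have "(f, W q h, pre (z [^] J q) (U q f)) \<in> R" unfolding R_def using q f by blast
        from n(1)[OF this] show ?thesis using meets_pre[OF fn _ W[OF q], of "z [^] J q"] z_closed by simp
      next
        case False
        \<comment> \<open>The shift is new, hence no earlier tuple constrains \<open>h\<close>: the
          target is still all of \<open>E\<close>.\<close>
        then have fK: "f \<in> K" "A q = {f}" using AL[OF q] f(1) by auto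
        have "quo (shift (\<nu> J') f) (p q) \<noteq> h" if "J' \<in> \<J>" for J'
          using n(2)[OF fK(1), of "\<nu> J'"] that f N0[OF f(1)] p[OF q] by (metis imageI quo_inj shift_in_N)
        then have "W q h = E" unfolding W_def target_def fK(2) by auto
        moreover have "pre (z [^] J q \<otimes> f n) (U q f) \<noteq> {}"
          using ne_open_pre[OF g U[OF q f(1)]] unfolding ne_open_def by blast
        ultimately show ?thesis by (auto simp: meets_def pre_def)
      qed
      then show ?thesis unfolding eq T by (intro ne_open_Int_pre g W q U f)
    qed
  qed
  then show ?case by blast
qed

text \<open>Here each sequence is its own divisor, so \<open>weight_less_self\<close> applies. The
  shifts are chosen without assuming \<open>singly A\<close>: quasi-homomorphisms return by
  \<open>quasi_hom_meets\<close>, the others receive distinct shifts.\<close>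

lemma singly_step:
  assumes A: "finite A" "A \<subseteq> N 0 - {\<lambda>_. \<one>}"
    and IH: "\<And>B. finite B \<Longrightarrow> B \<subseteq> N 0 - {\<lambda>_. \<one>} \<Longrightarrow> (weight B, weight A) \<in> lex less_than \<Longrightarrow> jointly B"
  shows "singly A"
  unfolding singly_def
proof (intro allI impI)
  fix R :: "((int \<Rightarrow> 'a) \<times> 'x set \<times> 'x set) set"
  assume R: "finite R" "\<forall>(f, V, U)\<in>R. f \<in> A \<and> ne_open V \<and> ne_open U"
  show "\<exists>n. \<forall>(f, V, U)\<in>R. meets (f n) V U"
  proof (cases "A = {}")
    case True
    then show ?thesis using R(2) by blast
  next
    case False
    have R': "fst q \<in> A" "fst q \<in> N 0" "ne_open (fst (snd q))" "ne_open (snd (snd q))" if "q \<in> R" for q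
      using bspec[OF R(2) that] A(2) by (auto simp: case_prod_beta)
    obtain l where l: "\<forall>q\<in>R. \<forall>x\<in>E. \<exists>j\<in>{0..l}. \<phi> (z [^] (j::int)) x \<in> fst (snd q)"
      using common_cover[OF R(1), of "\<lambda>q. fst (snd q)"] R' by blast
    let ?\<J> = "Pi\<^sub>E R (\<lambda>_. {0..l})"
    have fJ: "finite ?\<J>" using R(1) by (intro finite_PiE) auto
    have "\<exists>\<nu>. \<forall>q\<in>R. \<forall>h. ne_open (target ?\<J> \<nu> (\<lambda>J. J q) {fst q} (fst q) (\<lambda>_. snd (snd q)) h)"
    proof (rule choice_of_shifts[where L = "{f \<in> A. quasi_hom f}" and K = "{f \<in> A. \<not> quasi_hom f}"])
      fix R' F assume R': "finite R'" 
        "\<forall>(f, V, U)\<in>R'. f \<in> {f \<in> A. quasi_hom f} \<and> ne_open V \<and> ne_open U" "finite (F :: int set)"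
      have "\<exists>n. (\<forall>(f, V, U)\<in>R'. meets (f n) V U) \<and> n \<notin> F"
        by (rule quasi_hom_meets[OF R'(1) _ R'(3)]) (use R'(2) A(2) in fast)
      then obtain n where n: "\<forall>(f, V, U)\<in>R'. meets (f n) V U" "n \<notin> F" by blast
      have "shift n f \<noteq> shift n' f" if "f \<in> {f \<in> A. \<not> quasi_hom f}" "n' \<in> F" for f n'
        using shift_inj[of f n n'] that n(2) A(2) by blast
      then show "\<exists>n. (\<forall>(f, V, U)\<in>R'. meets (f n) V U) \<and> (\<forall>f\<in>{f \<in> A. \<not> quasi_hom f}. \<forall>n'\<in>F. shift n f \<noteq> shift n' f)"
        using n(1) by blast
    qed (use R(1) R' fJ in auto)
    then obtain \<nu> where \<nu>: "\<And>q h. q \<in> R \<Longrightarrow> ne_open (target ?\<J> \<nu> (\<lambda>J. J q) {fst q} (fst q) (\<lambda>_. snd (snd q)) h)"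
      by blast
    define B where "B = (\<lambda>(f, J). quo (shift (\<nu> J) f) f) ` (A \<times> ?\<J>) - {\<lambda>_. \<one>}"
    have BN: "quo (shift (\<nu> J) f) f \<in> N 0" if "f \<in> A" for f J 
      using that A(2) by (intro N_quo shift_in_N) auto
    have "jointly B"
    proof (rule IH)
      show "finite B" unfolding B_def using A(1) fJ by blast
      show "B \<subseteq> N 0 - {\<lambda>_. \<one>}" unfolding B_def using BN by auto
      show "(weight B, weight A) \<in> lex less_than"
        by (rule weight_less_self[OF A False]) (auto simp: B_def)
    qed
    then have "\<exists>n. \<forall>q\<in>R. \<exists>x\<in>fst (snd q). \<forall>f\<in>{fst q}. \<phi> (f n) x \<in> snd (snd q)"
      by (intro reduction[OF R(1) _ _ _ _ l \<nu>, where B = B]) (use R' in \<open>auto simp: B_def\<close>)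
    then show ?thesis by (fastforce simp: meets_def)
  qed
qed

text \<open>\<open>singly A\<close>, just obtained at the same weight, supplies the shifts; dividing
  by a sequence \<open>p\<close> of the deepest level then lowers the weight.\<close>

lemma jointly_step:
  assumes A: "finite A" "A \<subseteq> N 0 - {\<lambda>_. \<one>}"
    and IH: "\<And>B. finite B \<Longrightarrow> B \<subseteq> N 0 - {\<lambda>_. \<one>} \<Longrightarrow> (weight B, weight A) \<in> lex less_than \<Longrightarrow> jointly B"
  shows "jointly A"
  unfolding jointly_def
proof (intro allI impI)
  fix Q :: "('x set \<times> ((int \<Rightarrow> 'a) \<Rightarrow> 'x set)) set"
  assume Q: "finite Q" "\<forall>(V, U)\<in>Q. ne_open V \<and> (\<forall>f\<in>A. ne_open (U f))"
  have Q': "ne_open (fst q)" "\<And>f. f \<in> A \<Longrightarrow> ne_open (snd q f)" if "q \<in> Q" for q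
    using bspec[OF Q(2) that] by (auto simp: case_prod_beta)
  show "\<exists>n. \<forall>(V, U)\<in>Q. \<exists>x\<in>V. \<forall>f\<in>A. \<phi> (f n) x \<in> U f"
  proof (cases "A = {}")
    case True
    then show ?thesis using Q(2) unfolding ne_open_def by blast
  next
    case False
    define b where "b = (LEAST i. A \<inter> N (Suc i) = {})"
    have "N (Suc M) \<subseteq> {\<lambda>_. \<one>}" using N_Suc[of M] unfolding N_trivial .
    then have ex: "A \<inter> N (Suc M) = {}" using A(2) by blast
    have deep: "A \<inter> N (Suc b) = {}" unfolding b_def by (rule LeastI) (rule ex)
    have "A \<inter> N b \<noteq> {}"
    proof (cases b)
      case 0
      then show ?thesis using A(2) False by auto
    next
      case (Suc b')
      then show ?thesis using not_less_Least[of b' "\<lambda>i. A \<inter> N (Suc i) = {}"] unfolding b_def by auto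
    qed
    then obtain p where p: "p \<in> A" "p \<in> N b" by blast
    have p0: "p \<in> N 0" "p \<noteq> (\<lambda>_. \<one>)" using p A(2) by auto
    obtain l where l: "\<forall>q\<in>Q. \<forall>x\<in>E. \<exists>j\<in>{0..l}. \<phi> (z [^] (j::int)) x \<in> fst q"
      using common_cover[OF Q(1), of fst] Q' by blast
    let ?\<J> = "Pi\<^sub>E Q (\<lambda>_. {0..l})"
    have fJ: "finite ?\<J>" using Q(1) by (intro finite_PiE) auto
    have sing: "singly A" using singly_step[OF A IH] .
    have "\<exists>\<nu>. \<forall>q\<in>Q. \<forall>h. ne_open (target ?\<J> \<nu> (\<lambda>J. J q) A p (snd q) h)"
    proof (rule choice_of_shifts[where L = A and K = "{}" and A = "\<lambda>_. A" and p = "\<lambda>_. p" and U = snd])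
      fix R' and F :: "int set" 
      assume "finite R'" "\<forall>(f, V, U)\<in>R'. f \<in> A \<and> ne_open V \<and> ne_open U"
      then show "\<exists>n. (\<forall>(f, V, U)\<in>R'. meets (f n) V U) \<and> (\<forall>f\<in>{}. \<forall>n'\<in>F. shift n f \<noteq> shift n' f)"
        using sing unfolding singly_def by simp
    qed (use Q(1) Q' fJ A p0 in auto)
    then obtain \<nu> where \<nu>: "\<And>q h. q \<in> Q \<Longrightarrow> ne_open (target ?\<J> \<nu> (\<lambda>J. J q) A p (snd q) h)"
      by blast
    define B where "B = (\<lambda>(f, J). quo (shift (\<nu> J) f) p) ` (A \<times> ?\<J>) - {\<lambda>_. \<one>}"
    have BN: "quo (shift (\<nu> J) f) p \<in> N 0" if "f \<in> A" for f J 
      using that A(2) p0 by (intro N_quo shift_in_N) auto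
    have "jointly B"
    proof (rule IH)
      show "finite B" unfolding B_def using A(1) fJ by blast
      show "B \<subseteq> N 0 - {\<lambda>_. \<one>}" unfolding B_def using BN by auto
      show "(weight B, weight A) \<in> lex less_than"
        by (rule weight_less_deepest[OF A(1) _ p p0(2) deep]) (use A(2) in \<open>auto simp: B_def\<close>)
    qed
    then have "\<exists>n. \<forall>q\<in>Q. \<exists>x\<in>fst q. \<forall>f\<in>A. \<phi> (f n) x \<in> snd q f"
      by (intro reduction[OF Q(1) _ _ _ _ l \<nu>, where B = B]) (use Q' A(2) p0 in \<open>auto simp: B_def\<close>)
    then show ?thesis by (simp add: case_prod_beta)
  qed
qed

lemma jointly_nontrivial:
  assumes "finite A" "A \<subseteq> N 0 - {\<lambda>_. \<one>}"
  shows "jointly A"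
proof -
  have "wf (inv_image (lex less_than) weight)" by (intro wf_inv_image wf_lex wf_less_than)
  then show ?thesis using assms
  proof (induction A rule: wf_induct_rule)
    case (less A)
    have "jointly B" if "finite B" "B \<subseteq> N 0 - {\<lambda>_. \<one>}" "(weight B, weight A) \<in> lex less_than" for B
      using less.IH[of B] that by (simp add: inv_image_def)
    then show ?case by (rule jointly_step[OF less.prems])
  qed
qed

end

section \<open>Recurrence and piecewise syndeticity\<close>

text \<open>The thick set consists of the times at most \<open>K\<close> before a member of
  \<open>S\<close>. Adding its complement to \<open>S\<close> fills all gaps longer than
  \<open>K\<close>, giving a syndetic set with the right intersection.\<close>

lemma piecewise_syndeticI:
  assumes K: "K \<ge> 0" and S: "\<And>L::nat. \<exists>m. \<forall>i\<in>{0..int L}. \<exists>j\<in>{0..K}. m + i + j \<in> S"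
  shows "piecewise_syndetic S"
proof -
  define B where "B = {n. \<exists>j\<in>{0..K}. n + j \<in> S}"
  have "thick B"
    unfolding thick_def
  proof
    fix L :: nat
    obtain m where m: "\<forall>i\<in>{0..int L}. \<exists>j\<in>{0..K}. m + i + j \<in> S" using S by blast
    have "n \<in> B" if "n \<in> {m..m + int L}" for n
      using bspec[OF m, of "n - m"] that by (simp add: B_def)
    then show "\<exists>i. {i..i + int L} \<subseteq> B" by blast
  qed
  moreover have "syndetic (S \<union> - B)"
    unfolding syndetic_def
  proof (intro exI allI)
    fix i
    show "{i..i + int (nat K)} \<inter> (S \<union> - B) \<noteq> {}"
    proof (cases "i \<in> B")
      case True
      then obtain j where "j \<in> {0..K}" "i + j \<in> S" by (auto simp: B_def)
      then have "i + j \<in> {i..i + int (nat K)} \<inter> (S \<union> - B)" by auto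
      then show ?thesis by blast
    next
      case False
      then have "i \<in> {i..i + int (nat K)} \<inter> (S \<union> - B)" by auto
      then show ?thesis by blast
    qed
  qed
  moreover have "S = (S \<union> - B) \<inter> B"
    using K unfolding B_def by force
  ultimately show ?thesis unfolding piecewise_syndetic_def by blast
qed

context mixing_chain
begin

text \<open>The gap bound \<open>K\<close> is chosen before \<open>V\<close> and \<open>L\<close>;
  the Baire argument needs this order. It comes from minimality of \<open>g t\<close> in the
  quasi-homomorphic case and is 0 otherwise.\<close>

lemma recurrence:
  assumes g: "g \<in> N 0" "g \<noteq> (\<lambda>_. \<one>)" and U: "ne_open U"
  shows "\<exists>K\<ge>0. \<forall>V. ne_open V \<longrightarrow> (\<forall>L::nat. \<exists>m. \<exists>x\<in>V. \<forall>i\<in>{0..int L}. \<exists>j\<in>{0..K}. \<phi> (g (m + i + j)) x \<in> U)"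
proof (cases "quasi_hom g")
  case True
  then obtain s where s: "s \<noteq> 0" "shift s g = g" by (auto simp: quasi_hom_def)
  define t where "t = \<bar>s\<bar>"
  have t: "t > 0" "shift t g = g"
    using s(1) shift_fix_mult[OF g(1) s(2), of "sgn s"] abs_sgn[of s] by (simp_all add: t_def mult.commute)
  have c: "g t \<in> carrier G" "g t \<noteq> \<one>"
    using N_closed[OF g(1)] shift_fix_value_neq_one[OF g t(2)] t(1) by auto
  obtain l where l: "l \<ge> 0" "\<forall>x\<in>E. \<exists>j\<in>{0..l}. \<phi> (g t [^] (j::int)) x \<in> U"
    using cover[OF c] U unfolding ne_open_def by blast
  have ret: "\<exists>j\<in>{0..t * (l + 1)}. \<phi> (g (n + j)) x \<in> U" if x: "x \<in> E" for x n
  proof -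
    \<comment> \<open>The ceiling of \<open>n / t\<close>: the first multiple of \<open>t\<close>
      not before \<open>n\<close>.\<close>
    define q where "q = - ((- n) div t)"
    have q: "n \<le> q * t" "q * t < n + t"
    proof -
      have 1: "(- n) div t * t + (- n) mod t = - n" by (rule div_mult_mod_eq)
      have 2: "0 \<le> (- n) mod t" "(- n) mod t < t" using t(1) by auto
      have 3: "q * t = - ((- n) div t * t)" by (simp add: q_def)
      show "n \<le> q * t" "q * t < n + t" using 1 2 3 by linarith+
    qed
    obtain j where j: "j \<in> {0..l}" "\<phi> (g t [^] j) (\<phi> (g t [^] q) x) \<in> U"
      using l(2) act_closed[of "g t [^] q" x] x c by force
    have "g ((j + q) * t) = g t [^] j \<otimes> g t [^] q"
      using shift_fix_pow[OF g(1) t(2), of "j + q"] c by (simp add: int_pow_mult)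
    then have "\<phi> (g ((j + q) * t)) x \<in> U"
      using j(2) act_mult[of "g t [^] j" "g t [^] q" x] x c by simp
    moreover have "(j + q) * t - n \<in> {0..t * (l + 1)}"
    proof -
      have 1: "0 \<le> j * t" "j * t \<le> l * t" using j(1) t(1) by (auto intro: mult_right_mono)
      have 2: "(j + q) * t = j * t + q * t" "t * (l + 1) = l * t + t" by (simp_all add: algebra_simps)
      show ?thesis unfolding atLeastAtMost_iff using 1 2 q by linarith
    qed
    ultimately show ?thesis by (intro bexI[of _ "(j + q) * t - n"]) auto
  qed
  show ?thesis
  proof (rule exI[of _ "t * (l + 1)"], intro conjI allI impI)
    show "0 \<le> t * (l + 1)" using t l by simp
    fix V and L :: nat assume "ne_open V"
    then obtain x where "x \<in> V" "x \<in> E" using ne_open_subset unfolding ne_open_def by blast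
    then show "\<exists>m. \<exists>x\<in>V. \<forall>i\<in>{0..int L}. \<exists>j\<in>{0..t * (l + 1)}. \<phi> (g (m + i + j)) x \<in> U"
      using ret by blast
  qed
next
  case False
  have "\<exists>m. \<exists>x\<in>V. \<forall>i\<in>{0..int L}. \<phi> (g (m + i)) x \<in> U" if V: "ne_open V" for V and L :: nat
  proof -
    let ?A = "(\<lambda>i. shift i g) ` {0..int L}"
    have inj: "inj_on (\<lambda>i. shift i g) {0..int L}"
      using False shift_inj[OF g(1)] by (auto simp: inj_on_def)
    have "shift i g \<noteq> (\<lambda>_. \<one>)" for i
    proof
      assume "shift i g = (\<lambda>_. \<one>)"
      then have "shift i g = shift i (\<lambda>_. \<one>)" by (simp add: shift_def)
      then show False using shift_inj2[OF g(1) N_one] g(2) by blast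
    qed
    then have "jointly ?A" using shift_in_N[OF g(1)] by (intro jointly_nontrivial) auto
    \<comment> \<open>The targets must be indexed by sequences; injectivity of the shifts allows the
      index \<open>i\<close> to be read off from \<open>h\<close>.\<close>
    moreover define W where "W h = pre (g (the_inv_into {0..int L} (\<lambda>i. shift i g) h)) U" for h
    have "ne_open (W h)" for h
      unfolding W_def by (intro ne_open_pre U N_closed[OF g(1)])
    ultimately have "\<exists>m. \<forall>(V, U)\<in>{(V, W)}. \<exists>x\<in>V. \<forall>f\<in>?A. \<phi> (f m) x \<in> U f"
      using V unfolding jointly_def by (elim allE[of _ "{(V, W)}"]) auto
    then obtain m x where x: "x \<in> V" "\<forall>f\<in>?A. \<phi> (f m) x \<in> W f" by auto
    have "\<phi> (g (m + i)) x \<in> U" if i: "i \<in> {0..int L}" for i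
    proof -
      have "\<phi> (shift i g m) x \<in> pre (g i) U"
        using bspec[OF x(2) imageI[OF i]] the_inv_into_f_f[OF inj i] by (simp add: W_def)
      then have "\<phi> (g i \<otimes> shift i g m) x \<in> U"
        using act_mult[of "g i" "shift i g m" x] ne_open_subset[OF V x(1)] N_closed[OF g(1)] shift_closed[OF g(1)]
        by (simp add: pre_def)
      then show ?thesis using N_closed[OF g(1)] by (simp add: shift_def)
    qed
    then show ?thesis using x(1) by blast
  qed
  then show ?thesis by (intro exI[of _ "0 :: int"]) simp
qed

end

section \<open>The given expression as a polynomial sequence, and the category argument\<close>

context filtered_group
begin

lemma foldr_polyseq:
  assumes "\<And>i. i \<in> set xs \<Longrightarrow> h i \<in> polyseq 1"
  shows "(\<lambda>n. foldr (\<otimes>) (map (\<lambda>i. h i n) xs) \<one>) \<in> polyseq 1"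
  using assms
proof (induction xs)
  case Nil
  then show ?case using one_polyseq by simp
next
  case (Cons a xs)
  interpret S: subgroup "polyseq 1" "fun_group G" by (rule subgroup_polyseq) simp
  have "h a \<otimes>\<^bsub>fun_group G\<^esub> (\<lambda>n. foldr (\<otimes>) (map (\<lambda>i. h i n) xs) \<one>) \<in> polyseq 1"
    using Cons by (intro S.m_closed) auto
  then show ?case by (simp add: fun_group_def)
qed

lemma poly_expression_polyseq:
  assumes T: "\<And>i. i \<in> {1..k} \<Longrightarrow> T i \<in> carrier G" and p: "\<And>i. i \<in> {1..k} \<Longrightarrow> p i \<in> \<P>\<^sub>0"
    and H: "\<And>i j. j \<in> {1..k} \<Longrightarrow> i \<le> Suc (degree (p j)) \<Longrightarrow> H i = carrier G"
  shows "poly_expression G k T p \<in> polyseq 1"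
proof -
  have "(\<lambda>n. T i [^] \<lfloor>poly (p i) (of_int n)\<rfloor>) \<in> polyseq 1" if "i \<in> {1..k}" for i
  proof (rule pow_polyseq[OF T[OF that] H[OF that]])
    show "of_int \<lfloor>poly (p i) (of_int n)\<rfloor> = poly (p i) (of_int n)" for n
      using p[OF that] by (simp add: integral_polys_0_def)
  qed
  then show ?thesis
    unfolding poly_expression_def[abs_def] by (intro foldr_polyseq) auto
qed

end

lemma (in group) poly_expression_0:
  assumes T: "\<And>i. i \<in> {1..k} \<Longrightarrow> T i \<in> carrier G" and p: "\<And>i. i \<in> {1..k} \<Longrightarrow> p i \<in> \<P>\<^sub>0"
  shows "poly_expression G k T p 0 = \<one>"
proof -
  have "foldr (\<otimes>) (map (\<lambda>i. T i [^] \<lfloor>poly (p i) (of_int 0)\<rfloor>) xs) \<one> = \<one>" if "set xs \<subseteq> {1..k}" for xs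
    using that by (induction xs) (use T p in \<open>auto simp: integral_polys_0_def\<close>)
  from this[of "[1..<Suc k]"] show ?thesis unfolding poly_expression_def by fastforce
qed

text \<open>The base consists of balls of radius \<open>1 / Suc n\<close> around finite nets
  provided by compactness.\<close>

lemma compact_metric_countable_base:
  assumes "compact_space (mtopology_of X)"
  shows "\<exists>\<B>. countable \<B> \<and> (\<forall>B\<in>\<B>. openin (mtopology_of X) B) \<and>
    (\<forall>U x. openin (mtopology_of X) U \<and> x \<in> U \<longrightarrow> (\<exists>B\<in>\<B>. x \<in> B \<and> B \<subseteq> U))"
proof -
  interpret M: Metric_space "mspace X" "mdist X" by simp
  have X: "mtopology_of X = M.mtopology" by (simp add: mtopology_of_def)
  have "\<exists>C. finite C \<and> C \<subseteq> mspace X \<and> mspace X \<subseteq> (\<Union>c\<in>C. M.mball c (1 / Suc n))" for n :: nat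
  proof -
    let ?\<U> = "(\<lambda>c. M.mball c (1 / Suc n)) ` mspace X"
    have "\<forall>U\<in>?\<U>. openin M.mtopology U" "topspace M.mtopology \<subseteq> \<Union>?\<U>" by auto
    then obtain \<F> where \<F>: "finite \<F>" "\<F> \<subseteq> ?\<U>" "topspace M.mtopology \<subseteq> \<Union>\<F>"
      using assms unfolding X compact_space_alt by meson
    then obtain C where "C \<subseteq> mspace X" "finite C" "\<F> = (\<lambda>c. M.mball c (1 / Suc n)) ` C"
      using finite_subset_image by metis
    then show ?thesis using \<F> by auto
  qed
  then obtain C where C: "\<And>n. finite (C n)" "\<And>n. C n \<subseteq> mspace X" 
    "\<And>n::nat. mspace X \<subseteq> (\<Union>c\<in>C n. M.mball c (1 / Suc n))" by metis
  define \<B> where "\<B> = (\<Union>n. (\<lambda>c. M.mball c (1 / Suc n)) ` C n)"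
  have "countable \<B>" unfolding \<B>_def using C(1) by (intro countable_UN) (auto intro: countable_finite)
  moreover have "\<forall>B\<in>\<B>. openin (mtopology_of X) B" by (auto simp: X \<B>_def)
  moreover have "\<exists>B\<in>\<B>. x \<in> B \<and> B \<subseteq> U" if U: "openin (mtopology_of X) U" "x \<in> U" for U x
  proof -
    obtain r where r: "r > 0" "M.mball x r \<subseteq> U" and x: "x \<in> mspace X"
      using U unfolding X M.openin_mtopology by blast
    obtain n where n: "1 / Suc n < r / 2" using r(1) nat_approx_posE[of "r / 2"] by auto
    obtain c where c: "c \<in> C n" "x \<in> M.mball c (1 / Suc n)" using C(3)[of n] x by blast
    have "M.mball c (1 / Suc n) \<subseteq> M.mball x r"
    proof
      fix y assume y: "y \<in> M.mball c (1 / Suc n)"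
      then have "mdist X x y \<le> mdist X c x + mdist X c y"
        using c(2) M.triangle[of x c y] M.commute[of x c] by simp
      then show "y \<in> M.mball x r" using y c(2) n x by simp
    qed
    then show ?thesis using r(2) c by (intro bexI[of _ "M.mball c (1 / Suc n)"]) (auto simp: \<B>_def)
  qed
  ultimately show ?thesis by blast
qed

lemma piecewise_syndetic_UNIV: "piecewise_syndetic UNIV"
  by (rule piecewise_syndeticI[of 0]) auto

context mixing_chain
begin

text \<open>For each basic open set and each \<open>L\<close>, the points whose visits have gaps at
  most \<open>K U\<close> along some stretch of length \<open>L\<close> form an open set, dense by
  \<open>recurrence\<close>. Baire's theorem intersects these countably many sets.\<close>

lemma dense_piecewise_syndetic:
  assumes g: "g \<in> N 0" "g \<noteq> (\<lambda>_. \<one>)"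
    and Baire: "locally_compact_space X" "regular_space X"
    and \<B>: "countable \<B>" "\<And>B. B \<in> \<B> \<Longrightarrow> openin X B"
      "\<And>U x. openin X U \<Longrightarrow> x \<in> U \<Longrightarrow> \<exists>B\<in>\<B>. x \<in> B \<and> B \<subseteq> U"
  shows "\<exists>X\<^sub>0. gdelta_in X X\<^sub>0 \<and> X closure_of X\<^sub>0 = E \<and>
    (\<forall>x\<in>X\<^sub>0. \<forall>U. openin X U \<and> U \<noteq> {} \<longrightarrow> piecewise_syndetic {n. \<phi> (g n) x \<in> U})"
proof -
  have gcl: "g n \<in> carrier G" for n using N_closed[OF g(1)] .
  obtain K where K: "\<And>U. ne_open U \<Longrightarrow> 0 \<le> K U" "\<And>U V (L::nat). ne_open U \<Longrightarrow> ne_open V \<Longrightarrow>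
      \<exists>m. \<exists>x\<in>V. \<forall>i\<in>{0..int L}. \<exists>j\<in>{0..K U}. \<phi> (g (m + i + j)) x \<in> U"
    using recurrence[OF g] by metis
  define D where "D = (\<lambda>(U, L::nat). {x \<in> E. \<exists>m. \<forall>i\<in>{0..int L}. \<exists>j\<in>{0..K U}. \<phi> (g (m + i + j)) x \<in> U})"
  define \<D> where "\<D> = D ` ({B \<in> \<B>. B \<noteq> {}} \<times> UNIV)"
  have open_D: "openin X (D (U, L))" if U: "ne_open U" for U L
  proof -
    have eq: "D (U, L) = (\<Union>m. (\<Inter>i\<in>{0..int L}. \<Union>j\<in>{0..K U}. pre (g (m + i + j)) U) \<inter> topspace X)"
      unfolding D_def pre_def topspace_X prod.case by blast
    have "openin X ((\<Inter>i\<in>{0..int L}. \<Union>j\<in>{0..K U}. pre (g (m + i + j)) U) \<inter> topspace X)" for m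
      using U gcl unfolding ne_open_def by (intro openin_INT openin_Union) (auto intro!: openin_pre)
    then show ?thesis unfolding eq by (intro openin_Union) blast
  qed
  have dense_D: "X closure_of D (U, L) = topspace X" if U: "ne_open U" for U L
    unfolding dense_intersects_open
  proof (intro allI impI)
    fix V assume "openin X V \<and> V \<noteq> {}"
    then have V: "ne_open V" by (simp add: ne_open_def)
    obtain m x where "x \<in> V" "\<forall>i\<in>{0..int L}. \<exists>j\<in>{0..K U}. \<phi> (g (m + i + j)) x \<in> U"
      using K(2)[OF U V, of L] by blast
    then have "x \<in> D (U, L) \<inter> V" using ne_open_subset[OF V] unfolding D_def by blast
    then show "D (U, L) \<inter> V \<noteq> {}" by blast
  qed
  have ne: "ne_open B" if "B \<in> \<B>" "B \<noteq> {}" for B using that \<B>(2) by (simp add: ne_open_def)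
  \<comment> \<open>Ensures that the intersection is over a nonempty family, so that it stays inside
    the space.\<close>
  obtain B where B: "B \<in> \<B>" "B \<noteq> {}"
    using nonempty \<B>(3)[of "topspace X"] topspace_X openin_topspace by fastforce
  have cnt: "countable \<D>" unfolding \<D>_def using \<B>(1) by (intro countable_image countable_SIGMA) auto
  have "gdelta_in X (\<Inter>\<D>)"
    using cnt B ne open_D by (intro gdelta_in_Inter) (auto simp: \<D>_def intro!: open_imp_gdelta_in)
  moreover have "X closure_of \<Inter>\<D> = E"
    unfolding topspace_X[symmetric]
  proof (rule Baire_category[OF _ cnt])
    show "openin X T \<and> X closure_of T = topspace X" if T: "T \<in> \<D>" for T
    proof -
      obtain U L where "ne_open U" "T = D (U, L)" using T ne unfolding \<D>_def by blast
      then show ?thesis using open_D dense_D by simp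
    qed
  qed (use Baire in blast)
  moreover have "piecewise_syndetic {n. \<phi> (g n) x \<in> U}" 
    if x: "x \<in> \<Inter>\<D>" and U: "openin X U" "U \<noteq> {}" for x U
  proof -
    obtain B where B: "B \<in> \<B>" "B \<noteq> {}" "B \<subseteq> U" using U \<B>(3)[OF U(1)] by blast
    show ?thesis
    proof (rule piecewise_syndeticI)
      show "0 \<le> K B" using K(1) ne B by blast
      show "\<exists>m. \<forall>i\<in>{0..int L}. \<exists>j\<in>{0..K B}. m + i + j \<in> {n. \<phi> (g n) x \<in> U}" for L :: nat
      proof -
        have "x \<in> D (B, L)" using x B unfolding \<D>_def by blast
        then show ?thesis using B(3) unfolding D_def by blast
      qed
    qed
  qed
  ultimately show ?thesis by blast
qed

end

section \<open>Covering, mixing and torsion-freeness from the dynamical hypotheses\<close>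

locale mixing_minimal_tds = topological_dynamical_system G \<tau> X \<phi>
  for G (structure) and \<tau> and X :: "'x metric" and \<phi> +
  assumes weakly_mixing: "S \<in> carrier G \<Longrightarrow> S \<noteq> \<one> \<Longrightarrow>
      weakly_mixing_system integer_group X (cyclic_action G \<phi> S)"
    and minimal: "S \<in> carrier G \<Longrightarrow> S \<noteq> \<one> \<Longrightarrow> minimal_system integer_group X (cyclic_action G \<phi> S)"
begin

abbreviation E :: "'x set" where "E \<equiv> mspace X"

abbreviation XT :: "'x topology" where "XT \<equiv> mtopology_of X"

lemma continuous_act: "g \<in> carrier G \<Longrightarrow> continuous_map XT XT (\<phi> g)"
proof -
  assume g: "g \<in> carrier G"
  have "continuous_map XT (prod_topology \<tau> XT) (\<lambda>x. (g, x))"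
    using g topspace_eq by (simp add: continuous_map_pairedI)
  from continuous_map_compose[OF this continuous_action]
  show ?thesis by (simp add: o_def)
qed

lemma act_closed: "g \<in> carrier G \<Longrightarrow> x \<in> E \<Longrightarrow> \<phi> g x \<in> E"
  by (rule element_image) auto

lemma act_mult: "g \<in> carrier G \<Longrightarrow> h \<in> carrier G \<Longrightarrow> x \<in> E \<Longrightarrow> \<phi> (g \<otimes> h) x = \<phi> g (\<phi> h x)"
  by (rule composition_rule)

lemma act_one: "x \<in> E \<Longrightarrow> \<phi> \<one> x = x"
  by (metis id_eq_one restrict_apply')

lemma act_pow_add:
  assumes "S \<in> carrier G" "x \<in> E"
  shows "\<phi> (S [^] (m + n :: int)) x = \<phi> (S [^] m) (\<phi> (S [^] n) x)"
  using assms act_mult[of "S [^] m" "S [^] n" x] by (simp add: int_pow_mult)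

lemma openin_preimage:
  "g \<in> carrier G \<Longrightarrow> openin XT U \<Longrightarrow> openin XT {x \<in> E. \<phi> g x \<in> U}"
  using openin_continuous_map_preimage[OF continuous_act] by fastforce

text \<open>The points never visiting \<open>U\<close> form a proper closed invariant set, which
  minimality makes empty; compactness then leaves finitely many times.\<close>

lemma cover:
  assumes S: "S \<in> carrier G" "S \<noteq> \<one>" and U: "openin XT U" "U \<noteq> {}"
  shows "\<exists>l\<ge>0. \<forall>x\<in>E. \<exists>j\<in>{0..l}. \<phi> (S [^] (j::int)) x \<in> U"
proof -
  define P where "P n = {x \<in> E. \<phi> (S [^] (n::int)) x \<in> U}" for n
  have P: "openin XT (P n)" for n unfolding P_def using S U by (intro openin_preimage) auto
  have "U \<subseteq> E" using U openin_subset by fastforce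
  then have UP: "U \<subseteq> P 0" using act_one by (auto simp: P_def)
  have "E - (\<Union>n. P n) = {}"
  proof (rule ccontr)
    assume ne: "E - (\<Union>n. P n) \<noteq> {}"
    have "closedin XT (E - (\<Union>n. P n))"
      using closedin_diff[OF closedin_topspace, of XT "\<Union>n. P n"] P by (auto intro!: openin_Union)
    moreover have "invariant_set integer_group (cyclic_action G \<phi> S) (E - (\<Union>n. P n))"
      unfolding invariant_set_def cyclic_action_def
    proof safe
      fix k :: int and x assume x: "x \<in> E" "x \<notin> (\<Union>n. P n)"
      then show "\<phi> (S [^] k) x \<in> E" using S act_closed by simp
      fix n assume "\<phi> (S [^] k) x \<in> P n"
      then have "x \<in> P (n + k)" using x S act_pow_add[OF S(1) x(1), of n k] by (simp add: P_def)
      then show False using x by blast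
    qed
    moreover have "E - (\<Union>n. P n) \<subset> E" using UP U(2) \<open>U \<subseteq> E\<close> by blast
    ultimately show False using minimal[OF S] ne unfolding minimal_system_def by blast
  qed
  then have "\<forall>U\<in>range P. openin XT U" "topspace XT \<subseteq> \<Union>(range P)" using P by auto
  then obtain \<F> where \<F>: "finite \<F>" "\<F> \<subseteq> range P" "E \<subseteq> \<Union>\<F>"
    using compact unfolding compact_space_alt by (metis topspace_mtopology_of)
  then obtain I where I: "finite I" "\<F> = P ` I" by (metis finite_subset_image)
  \<comment> \<open>These times may be negative; advancing by \<open>l\<close> first brings them
    into \<open>{0..2 * l}\<close>.\<close>
  obtain l where l: "\<forall>n\<in>I. \<bar>n\<bar> \<le> l" "l \<ge> 0"
  proof
    show "\<forall>n\<in>I. \<bar>n\<bar> \<le> Max (insert 0 (abs ` I))" "Max (insert 0 (abs ` I)) \<ge> 0"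
      using I(1) by (auto intro: Max_ge)
  qed
  have "\<exists>j\<in>{0..2 * l}. \<phi> (S [^] j) x \<in> U" if x: "x \<in> E" for x
  proof -
    have "\<phi> (S [^] l) x \<in> E" using x S act_closed by simp
    then obtain n where n: "n \<in> I" "\<phi> (S [^] l) x \<in> P n" using \<F>(3) I(2) by blast
    then have "\<phi> (S [^] (n + l)) x \<in> U" using act_pow_add[OF S(1) x, of n l] by (simp add: P_def)
    then show ?thesis using bspec[OF l(1) n(1)] by (intro bexI[of _ "n + l"]) auto
  qed
  then show ?thesis using l(2) by (intro exI[of _ "2 * l"]) auto
qed

text \<open>The union of all simultaneous translates of \<open>U1 \<times> U2\<close> is open and
  invariant in the product, hence dense, and so meets \<open>V1 \<times> V2\<close>. The time found
  leads from the \<open>V\<close> sets to the \<open>U\<close> sets, so its negative is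
  used.\<close>

lemma mixing:
  assumes S: "S \<in> carrier G" "S \<noteq> \<one>" and U: "openin XT U1" "U1 \<noteq> {}" "openin XT U2" "U2 \<noteq> {}"
    and V: "openin XT V1" "V1 \<noteq> {}" "openin XT V2" "V2 \<noteq> {}"
  shows "\<exists>n::int. (\<exists>x\<in>U1. \<phi> (S [^] n) x \<in> V1) \<and> (\<exists>x\<in>U2. \<phi> (S [^] n) x \<in> V2)"
proof -
  define P where "P W n = {x \<in> E. \<phi> (S [^] (n::int)) x \<in> W}" for W n
  have P: "openin XT (P W n)" if "openin XT W" for W n
    unfolding P_def using S that by (intro openin_preimage) auto
  have sub: "U1 \<subseteq> E" "U2 \<subseteq> E" "V1 \<subseteq> E" "V2 \<subseteq> E" using U V openin_subset by fastforce+
  define O' where "O' = (\<Union>n. P U1 n \<times> P U2 n)"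
  have "openin (mtopology_of (prod_metric X X)) O'"
    unfolding O'_def using P U by (auto intro!: openin_Union simp: openin_prod_Times_iff)
  moreover have "U1 \<times> U2 \<subseteq> O'"
  proof -
    have "U1 \<subseteq> P U1 0" "U2 \<subseteq> P U2 0" using sub act_one by (auto simp: P_def)
    then show ?thesis unfolding O'_def by blast
  qed
  then have "O' \<noteq> {}" using U by blast
  moreover have "invariant_set integer_group (diagonal_action X (cyclic_action G \<phi> S)) O'"
    unfolding invariant_set_def
  proof (intro ballI subsetI)
    fix k :: int and w assume "w \<in> diagonal_action X (cyclic_action G \<phi> S) k ` O'"
    then obtain a b where w: "w = diagonal_action X (cyclic_action G \<phi> S) k (a, b)" "(a, b) \<in> O'" by force
    then obtain n where n: "a \<in> P U1 n" "b \<in> P U2 n" unfolding O'_def by blast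
    then have ab: "a \<in> E" "b \<in> E" by (auto simp: P_def)
    have "\<phi> (S [^] k) c \<in> P W (n - k)" if "c \<in> P W n" for c W
      using that S act_closed act_pow_add[OF S(1), of c "n - k" k] by (simp add: P_def)
    then have "(\<phi> (S [^] k) a, \<phi> (S [^] k) b) \<in> O'" using n unfolding O'_def by blast
    then show "w \<in> O'"
      using ab w by (simp add: diagonal_action_def cyclic_action_def)
  qed
  ultimately have "mtopology_of (prod_metric X X) closure_of O' = mspace (prod_metric X X)"
    using weakly_mixing[OF S] unfolding weakly_mixing_system_def transitive_system_def by blast
  then have "prod_topology XT XT closure_of O' = topspace (prod_topology XT XT)" by simp
  moreover have "openin (prod_topology XT XT) (V1 \<times> V2)" "V1 \<times> V2 \<noteq> {}"
    using V by (auto simp: openin_prod_Times_iff)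
  ultimately have "O' \<inter> (V1 \<times> V2) \<noteq> {}" unfolding dense_intersects_open by blast
  then obtain a b n where ab: "a \<in> V1" "b \<in> V2" "a \<in> P U1 n" "b \<in> P U2 n" unfolding O'_def by blast
  have ret: "\<phi> (S [^] (- n)) (\<phi> (S [^] n) c) = c" if "c \<in> E" for c
    using act_pow_add[OF S(1) that, of "- n" n] act_one[OF that] by simp
  have "\<exists>x\<in>U1. \<phi> (S [^] (- n)) x \<in> V1"
      using ab ret[of a] by (intro bexI[of _ "\<phi> (S [^] n) a"]) (auto simp: P_def)
  moreover have "\<exists>x\<in>U2. \<phi> (S [^] (- n)) x \<in> V2"
      using ab ret[of b] by (intro bexI[of _ "\<phi> (S [^] n) b"]) (auto simp: P_def)
  ultimately show ?thesis by blast
qed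

lemma Hausdorff_XT: "Hausdorff_space XT"
  by (simp add: mtopology_of_def Metric_space.Hausdorff_space_mtopology)

text \<open>A nontrivial element of finite order has a finite orbit, which minimality makes the
  whole space. The space is then discrete, and mixing would send \<open>x\<close> to both
  \<open>x\<close> and \<open>y\<close> at the same time.\<close>

lemma torsion_free:
  assumes xy: "x \<in> E" "y \<in> E" "x \<noteq> y" and c: "c \<in> carrier G" and n: "n \<noteq> 0" "c [^] (n::int) = \<one>"
  shows "c = \<one>"
proof (rule ccontr)
  assume c1: "c \<noteq> \<one>"
  define t where "t = \<bar>n\<bar>"
  have t: "t > 0" "c [^] t = \<one>"
    using n c unfolding t_def by (auto simp: abs_if int_pow_neg)
  have md: "c [^] i = c [^] (i mod t)" for i :: int
  proof -
    have "c [^] i = c [^] (t * (i div t) + i mod t)" by simp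
    also have "\<dots> = (c [^] t) [^] (i div t) \<otimes> c [^] (i mod t)"
      using c by (simp only: int_pow_mult int_pow_pow)
    finally show ?thesis using t(2) c by simp
  qed
  let ?O = "(\<lambda>i. \<phi> (c [^] i) x) ` {0..<t}"
  have O: "\<phi> (c [^] i) x \<in> ?O" for i :: int
    using md[of i] t(1) by (intro image_eqI[of _ _ "i mod t"]) auto
  have OE: "?O \<subseteq> E" using c xy act_closed by auto
  then have cl: "closedin XT ?O" using Hausdorff_XT by (intro closedin_Hausdorff_finite) auto
  have "invariant_set integer_group (cyclic_action G \<phi> c) ?O"
    unfolding invariant_set_def cyclic_action_def
  proof (intro ballI subsetI)
    fix k :: int and w assume "w \<in> \<phi> (c [^] k) ` ?O"
    then obtain i :: int where "w = \<phi> (c [^] k) (\<phi> (c [^] i) x)" by blast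
    then have "w = \<phi> (c [^] (k + i)) x" using act_pow_add[OF c xy(1)] by simp
    then show "w \<in> ?O" using O by simp
  qed
  moreover have "?O \<noteq> {}" using O by blast
  ultimately have "?O = E"
    using minimal[OF c c1] OE cl unfolding minimal_system_def by blast
  moreover have "finite ?O" by simp
  ultimately have "finite E" by simp
  then have "XT = discrete_topology E"
    using Hausdorff_XT by (intro finite_topspace_imp_discrete_topology) auto
  then have "openin XT {x}" "openin XT {y}" using xy by auto
  then have "\<exists>n::int. (\<exists>u\<in>{x}. \<phi> (c [^] n) u \<in> {x}) \<and> (\<exists>u\<in>{x}. \<phi> (c [^] n) u \<in> {y})"
    by (intro mixing[OF c c1]) auto
  then show False using xy(3) by auto
qed

lemma mixing_system_tds: "E \<noteq> {} \<Longrightarrow> mixing_system G E \<phi> XT"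
  by (intro mixing_system.intro mixing_system_axioms.intro group_axioms group_action_axioms)
    (use continuous_act cover mixing in auto)

end

theorem theorem1p4:
  fixes G :: "('g, 'm) monoid_scheme" (structure)
    and \<tau> :: "'g topology"
    and X :: "'x metric"
    and \<phi> :: "'g \<Rightarrow> 'x \<Rightarrow> 'x"
    and k :: nat
    and T :: "nat \<Rightarrow> 'g"
    and p :: "nat \<Rightarrow> rat poly"
  assumes "topological_dynamical_system G \<tau> X \<phi>"
    and "nilpotent_group G"
    and "\<And>S. S \<in> carrier G \<Longrightarrow> S \<noteq> \<one> \<Longrightarrow>
           weakly_mixing_system integer_group X (cyclic_action G \<phi> S) \<and>
           minimal_system integer_group X (cyclic_action G \<phi> S)"
    and "\<And>i. i \<in> {1..k} \<Longrightarrow> T i \<in> carrier G"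
    and "\<And>i. i \<in> {1..k} \<Longrightarrow> p i \<in> \<P>\<^sub>0"
    and "\<not> poly_expression G k T p constant_on UNIV"
  shows "\<exists>X\<^sub>0. gdelta_in (mtopology_of X) X\<^sub>0 \<and>
               mtopology_of X closure_of X\<^sub>0 = mspace X \<and>
               (\<forall>x \<in> X\<^sub>0. \<forall>U. openin (mtopology_of X) U \<and> U \<noteq> {} \<longrightarrow>
                  piecewise_syndetic {n::int. \<phi> (poly_expression G k T p n) x \<in> U})"
proof -
  interpret tds: topological_dynamical_system G \<tau> X \<phi> by (rule assms(1))
  interpret tds: mixing_minimal_tds G \<tau> X \<phi>
    using assms(3) by unfold_locales auto
  let ?g = "poly_expression G k T p"
  obtain s where s: "lower_central_series G s = {\<one>}" using assms(2) by (auto simp: nilpotent_group_def)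
  \<comment> \<open>Exceeds every degree by at least one, so that the filtration is the whole group
    up to index \<open>Suc (degree (p j))\<close>.\<close>
  define K where "K = Suc (\<Sum>i\<in>{1..k}. degree (p i))"
  define H where "H = (\<lambda>i. lower_central_series G (LEAST a. i \<le> K * 2 ^ a))"
  define M where "M = Suc (K * 2 ^ s)"
  interpret filtered_group G H M
    unfolding H_def M_def by (rule tds.filtered_group_lower_central_series[OF s]) (simp add: K_def)
  have HG: "H i = carrier G" if ij: "j \<in> {1..k}" "i \<le> Suc (degree (p j))" for i j
  proof -
    have "degree (p j) \<le> (\<Sum>i\<in>{1..k}. degree (p i))" using ij(1) by (intro member_le_sum) auto
    then have "i \<le> K" using ij(2) by (simp add: K_def)
    then have "(LEAST a. i \<le> K * 2 ^ a) = 0" by (intro Least_eq_0) simp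
    then show ?thesis by (simp add: H_def)
  qed
  have g1: "?g \<in> polyseq 1" by (rule poly_expression_polyseq[OF assms(4,5) HG])
  have gcl: "?g n \<in> carrier G" for n using polyseq_closed[OF g1] by (simp add: tds.carrier_fun_group)
  show ?thesis
  proof (cases "\<exists>x\<in>mspace X. \<exists>y\<in>mspace X. x \<noteq> y")
    \<comment> \<open>On a space with at most one point the dynamical hypotheses do not make the
      group torsion free; there every visit set is all of the integers.\<close>
    case False
    have "piecewise_syndetic {n. \<phi> (?g n) x \<in> U}" 
      if xU: "x \<in> mspace X" "openin (mtopology_of X) U" "U \<noteq> {}" for x U
    proof -
      obtain u where "u \<in> U" "u \<in> mspace X" using xU openin_subset[OF xU(2)] by auto
      moreover have "\<phi> (?g n) x \<in> mspace X" for n by (rule tds.act_closed[OF gcl xU(1)])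
      ultimately have "\<phi> (?g n) x \<in> U" for n using False by metis
      then show ?thesis using piecewise_syndetic_UNIV by simp
    qed
    moreover have "gdelta_in (mtopology_of X) (mspace X)"
      using gdelta_in_topspace[of "mtopology_of X"] by simp
    moreover have "mtopology_of X closure_of mspace X = mspace X"
      using closure_of_topspace[of "mtopology_of X"] by simp
    ultimately show ?thesis by blast
  next
    case True
    then obtain x y where xy: "x \<in> mspace X" "y \<in> mspace X" "x \<noteq> y" by blast
    have gne: "?g \<noteq> (\<lambda>_. \<one>)" using assms(6) by (auto simp: constant_on_def)
    then have "carrier G \<noteq> {\<one>}" using gcl by fastforce
    then obtain z where z: "z \<in> carrier G" "z \<noteq> \<one>" "\<And>g. g \<in> carrier G \<Longrightarrow> z \<otimes> g = g \<otimes> z"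
      using tds.nilpotent_center[OF assms(2)] by metis
    define N where "N = (\<lambda>i. {f \<in> polyseq (Suc i). f 0 = \<one>})"
    have "f = (\<lambda>_. \<one>)" if "f \<in> N 0" "t \<noteq> 0" "\<And>m. f (m + t) = f m" for f t
    proof
      show "f m = \<one>" for m
        using periodic_polyseq_const[OF tds.torsion_free[OF xy], where f = f and i = "Suc 0" and t = t and m = m] that
        by (simp add: N_def)
    qed
    then interpret mixing_chain G "mspace X" \<phi> "mtopology_of X" N M z
      using xy z seq_chain_polyseq
      by (intro mixing_chain.intro mixing_chain_axioms.intro tds.mixing_system_tds) (auto simp: N_def)
    have "?g \<in> N 0" using g1 tds.poly_expression_0[OF assms(4,5)] by (simp add: N_def)
    moreover have "locally_compact_space (mtopology_of X)" 
      using tds.compact by (rule compact_imp_locally_compact_space)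
    moreover have "regular_space (mtopology_of X)"
      using tds.compact tds.Hausdorff_XT by (intro compact_Hausdorff_imp_regular_space)
    ultimately show ?thesis
      using compact_metric_countable_base[OF tds.compact] dense_piecewise_syndetic[OF _ gne] by metis
  qed
qed

end
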